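(* Let $K$ be a finite locally oriented simplicial complex, let $\mathscr{C}$ be a cosheaf of finite dimensional $\mathbb{F}$-vector spaces on $K$, and let $\Sigma$ be a $\mathscr{C}$-compatible acyclic partial matching on $K$. For each $k$ let $$C_{k}^{\Sigma}(K;\mathscr{C}):=\bigoplus_{\alpha}\mathscr{C}_{\alpha},$$ the direct sum being over all $\Sigma$-critical simplices $\alpha\in K_k$, and let $\partial_k^{\mathscr{C},\Sigma}:C_k^\Sigma(K;\mathscr{C})\to C_{k-1}^\Sigma(K;\mathscr{C})$ be the linear map whose block $\mathscr{C}_\alpha\to\mathscr{C}_\omega$ (for $\Sigma$-critical simplices $\alpha\in K_k$, $\omega\in K_{k-1}$) is $$[\alpha:\omega]_{\Sigma}:=[\alpha:\omega]\cdot\mathscr{C}_{\alpha\rhd\omega}+\sum_{\rho=(\sigma\lhd\cdots\lhd\tau)}[\tau:\omega]\cdot\mathscr{C}_{\tau\rhd\omega}\circ\omega_{\rho}^{\mathscr{C}}\circ\mathscr{C}_{\alpha\rhd\sigma}\cdot[\alpha:\sigma],$$ where the sum is over all $\Sigma$-paths $\rho$, with first simplex denoted $\sigma$ and last simplex denoted $\tau$. Then $(C_\bullet^\Sigma(K;\mathscr{C}),\partial_\bullet^{\mathscr{C},\Sigma})$ is a chain complex, and it is quasi-isomorphic to $C_\bullet(K;\mathscr{C})$.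
   Context: $\mathbb{F}$ is a field. A finite simplicial complex $K$ (simplices are nonempty) is regarded as a poset under the face relation $\leq$; $K_k$ is its set of $k$-dimensional simplices. A local orientation is a total ordering of the vertices of each simplex such that the ordering of each face is the restriction of the ordering of the simplex. For $\sigma=(v_0,\dots,v_k)$ put $\sigma_{-i}=(v_0,\dots,v_{i-1},v_{i+1},\dots,v_k)$. The incidence symbol is $[\sigma:\tau]=+1$ if $\tau=\sigma_{-i}$ with $i$ even, $-1$ if $\tau=\sigma_{-i}$ with $i$ odd, and $0$ otherwise. Terms with a vanishing incidence symbol are understood to be zero, even when the accompanying map is undefined. A cosheaf on $K$ is a functor $\mathscr{C}:(K,\leq)^{\mathrm{op}}\to\mathsf{Vect}^{\mathrm{fd}}_{\mathbb{F}}$; write $\mathscr{C}_\sigma=\mathscr{C}(\sigma)$, and $\mathscr{C}_{\sigma\geq\tau}:\mathscr{C}_\sigma\to\mathscr{C}_\tau$ for the map associated to $\tau\leq\sigma$. The chain complex $C_\bullet(K;\mathscr{C})$ has $C_k(K;\mathscr{C})=\bigoplus_{\sigma\in K_k}\mathscr{C}_\sigma$, and the block $\mathscr{C}_\sigma\to\mathscr{C}_\tau$ of $\partial_k$ is $[\sigma:\tau]\cdot\mathscr{C}_{\sigma\geq\tau}$. Write $\sigma\lhd\tau$ (or $\tau\rhd\sigma$) when $\sigma$ is a codimension one face of $\tau$, and $\mathscr{C}_{\tau\rhd\sigma}$ for $\mathscr{C}_{\tau\geq\sigma}$ in this case. A partial matching on $K$ is a set $\Sigma$ of pairs $(\sigma\lhd\tau)$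 of simplices of $K$ such that each simplex appears in at most one pair. A simplex is $\Sigma$-critical if it appears in no pair. A $\Sigma$-path is a zig-zag of distinct simplices $\rho=(\sigma_1\lhd\tau_1\rhd\sigma_2\lhd\tau_2\rhd\cdots\rhd\sigma_m\lhd\tau_m)$, $m\geq1$, with $(\sigma_i\lhd\tau_i)\in\Sigma$ for all $i$. It is gradient if $m=1$ or $\sigma_1$ is not a face of $\tau_m$. $\Sigma$ is acyclic if all its paths are gradient. An acyclic partial matching is $\mathscr{C}$-compatible if $\mathscr{C}_{\tau\rhd\sigma}$ is an isomorphism for every $(\sigma\lhd\tau)\in\Sigma$. In that case the weight of a $\Sigma$-path $\rho=(\sigma_1\lhd\tau_1\rhd\sigma_2\lhd\tau_2\rhd\cdots\rhd\sigma_m\lhd\tau_m)$ is the linear map $\mathscr{C}_{\sigma_1}\to\mathscr{C}_{\tau_m}$ $$\omega_\rho^{\mathscr{C}}=\varepsilon_\rho\cdot\mathscr{C}^{-1}_{\tau_m\rhd\sigma_m}\circ\mathscr{C}_{\tau_{m-1}\rhd\sigma_m}\circ\cdots\circ\mathscr{C}^{-1}_{\tau_2\rhd\sigma_2}\circ\mathscr{C}_{\tau_1\rhd\sigma_2}\circ\mathscr{C}^{-1}_{\tau_1\rhd\sigma_1},$$ with $\varepsilon_\rho=(-1)^m[\tau_m:\sigma_m][\tau_{m-1}:\sigma_m]\cdots[\tau_2:\sigma_2][\tau_1:\sigma_2][\tau_1:\sigma_1]$. *)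

theory Defs
  imports Complex_Main "HOL-Library.Function_Algebras"
begin

section \<open>Simplicial complexes and local orientations\<close>

definition finite_simplicial_complex :: "'v set set \<Rightarrow> bool" where
  "finite_simplicial_complex K \<longleftrightarrow>
     finite K \<and> (\<forall>\<sigma>\<in>K. finite \<sigma> \<and> \<sigma> \<noteq> {}) \<and>
     (\<forall>\<sigma>\<in>K. \<forall>\<tau>. \<tau> \<subseteq> \<sigma> \<longrightarrow> \<tau> \<noteq> {} \<longrightarrow> \<tau> \<in> K)"

definition simplices_of_dim :: "'v set set \<Rightarrow> int \<Rightarrow> 'v set set" where
  "simplices_of_dim K k = {\<sigma> \<in> K. int (card \<sigma>) = k + 1}"

definition codim_one_face :: "'v set \<Rightarrow> 'v set \<Rightarrow> bool" where
  "codim_one_face \<sigma> \<tau> \<longleftrightarrow> \<sigma> \<subseteq> \<tau> \<and> card \<tau> = card \<sigma> + 1"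

definition local_orientation :: "'v set set \<Rightarrow> ('v set \<Rightarrow> 'v rel) \<Rightarrow> bool" where
  "local_orientation K ord \<longleftrightarrow>
     (\<forall>\<sigma>\<in>K. linear_order_on \<sigma> (ord \<sigma>)) \<and>
     (\<forall>\<sigma>\<in>K. \<forall>\<tau>\<in>K. \<tau> \<subseteq> \<sigma> \<longrightarrow> ord \<tau> = ord \<sigma> \<inter> \<tau> \<times> \<tau>)"

text \<open>For \<open>\<sigma> = (v\<^sub>0, \<dots>, v\<^sub>k)\<close>, listed in increasing order, \<open>v\<^sub>i\<close> is the vertex
  with exactly \<open>i\<close> strict predecessors, and \<open>omit_vertex ord \<sigma> i\<close> is \<open>\<sigma>\<close> without \<open>v\<^sub>i\<close>.\<close>

definition omit_vertex :: "('v set \<Rightarrow> 'v rel) \<Rightarrow> 'v set \<Rightarrow> nat \<Rightarrow> 'v set" where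
  "omit_vertex ord \<sigma> i = \<sigma> - {v \<in> \<sigma>. card {u \<in> \<sigma>. u \<noteq> v \<and> (u, v) \<in> ord \<sigma>} = i}"

definition incidence :: "('v set \<Rightarrow> 'v rel) \<Rightarrow> 'v set \<Rightarrow> 'v set \<Rightarrow> int" where
  "incidence ord \<sigma> \<tau> =
     (if \<exists>i<card \<sigma>. even i \<and> \<tau> = omit_vertex ord \<sigma> i then 1
      else if \<exists>i<card \<sigma>. odd i \<and> \<tau> = omit_vertex ord \<sigma> i then -1
      else 0)"

section \<open>Cosheaves\<close>

definition linear_between ::
    "('k::field \<Rightarrow> 'a::ab_group_add \<Rightarrow> 'a) \<Rightarrow> ('k \<Rightarrow> 'b::ab_group_add \<Rightarrow> 'b) \<Rightarrow>
     'a set \<Rightarrow> 'b set \<Rightarrow> ('a \<Rightarrow> 'b) \<Rightarrow> bool" where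
  "linear_between s1 s2 V W f \<longleftrightarrow>
     (\<forall>x\<in>V. f x \<in> W) \<and>
     (\<forall>x\<in>V. \<forall>y\<in>V. f (x + y) = f x + f y) \<and>
     (\<forall>c. \<forall>x\<in>V. f (s1 c x) = s2 c (f x))"

text \<open>The stalks \<open>St \<sigma>\<close> are finite dimensional subspaces of one ambient vector space, of
  arbitrary dimension; up to isomorphism, any family of vector spaces is of this form (take the
  direct sum as ambient space).
  The map attached to \<open>\<tau> \<subseteq> \<sigma>\<close> is \<open>ext \<sigma> \<tau>\<close>; its values off \<open>St \<sigma>\<close>, and \<open>ext \<sigma> \<tau>\<close> for
  \<open>\<tau>\<close> not a face of \<open>\<sigma>\<close>, are irrelevant.\<close>

locale cosheaf = vector_space scale
  for scale :: "'k::field \<Rightarrow> 'a::ab_group_add \<Rightarrow> 'a" +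
  fixes K :: "'v set set"
    and St :: "'v set \<Rightarrow> 'a set"
    and ext :: "'v set \<Rightarrow> 'v set \<Rightarrow> 'a \<Rightarrow> 'a"
  assumes stalk_subspace: "\<sigma> \<in> K \<Longrightarrow> subspace (St \<sigma>)"
    and stalk_finite_dim: "\<sigma> \<in> K \<Longrightarrow> \<exists>B. finite B \<and> span B = St \<sigma>"
    and ext_linear: "\<lbrakk>\<sigma> \<in> K; \<tau> \<in> K; \<tau> \<subseteq> \<sigma>\<rbrakk> \<Longrightarrow>
          linear_between scale scale (St \<sigma>) (St \<tau>) (ext \<sigma> \<tau>)"
    and ext_id: "\<lbrakk>\<sigma> \<in> K; x \<in> St \<sigma>\<rbrakk> \<Longrightarrow> ext \<sigma> \<sigma> x = x"
    and ext_comp: "\<lbrakk>\<sigma> \<in> K; \<tau> \<in> K; \<rho> \<in> K; \<rho> \<subseteq> \<tau>; \<tau> \<subseteq> \<sigma>; x \<in> St \<sigma>\<rbrakk> \<Longrightarrow>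
          ext \<tau> \<rho> (ext \<sigma> \<tau> x) = ext \<sigma> \<rho> x"

section \<open>Chain complexes and quasi-isomorphism\<close>

text \<open>Complexes are indexed by the integers. The chain groups are subspaces of an ambient type
  and \<open>bd C k\<close> maps degree \<open>k\<close> to degree \<open>k - 1\<close>; only its values on chains matter.\<close>

record 'm complex_data =
  chains :: "int \<Rightarrow> 'm set"
  bd :: "int \<Rightarrow> 'm \<Rightarrow> 'm"

definition is_chain_complex ::
    "('k::field \<Rightarrow> 'm::ab_group_add \<Rightarrow> 'm) \<Rightarrow> 'm complex_data \<Rightarrow> bool" where
  "is_chain_complex s C \<longleftrightarrow>
     (\<forall>k. module.subspace s (chains C k)) \<and>
     (\<forall>k. linear_between s s (chains C k) (chains C (k - 1)) (bd C k)) \<and>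
     (\<forall>k. \<forall>x\<in>chains C k. bd C (k - 1) (bd C k x) = 0)"

definition cycles :: "'m::ab_group_add complex_data \<Rightarrow> int \<Rightarrow> 'm set" where
  "cycles C k = {x \<in> chains C k. bd C k x = 0}"

definition boundaries :: "'m::ab_group_add complex_data \<Rightarrow> int \<Rightarrow> 'm set" where
  "boundaries C k = bd C (k + 1) ` chains C (k + 1)"

definition homology :: "'m::ab_group_add complex_data \<Rightarrow> int \<Rightarrow> 'm set set" where
  "homology C k =
     cycles C k // {(x, y). x \<in> cycles C k \<and> y \<in> cycles C k \<and> x - y \<in> boundaries C k}"

definition is_chain_map ::
    "('k::field \<Rightarrow> 'm::ab_group_add \<Rightarrow> 'm) \<Rightarrow> 'm complex_data \<Rightarrow> 'm complex_data \<Rightarrow>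
     (int \<Rightarrow> 'm \<Rightarrow> 'm) \<Rightarrow> bool" where
  "is_chain_map s C D f \<longleftrightarrow>
     (\<forall>k. linear_between s s (chains C k) (chains D k) (f k)) \<and>
     (\<forall>k. \<forall>x\<in>chains C k. f (k - 1) (bd C k x) = bd D k (f k x))"

text \<open>The class of \<open>f x\<close>, where \<open>x\<close> is any representative of the homology class \<open>X\<close>.\<close>

definition homology_map ::
    "'m::ab_group_add complex_data \<Rightarrow> (int \<Rightarrow> 'm \<Rightarrow> 'm) \<Rightarrow> int \<Rightarrow> 'm set \<Rightarrow> 'm set" where
  "homology_map D f k X = {y \<in> cycles D k. \<exists>x\<in>X. f k x - y \<in> boundaries D k}"

definition is_quasi_isomorphism ::
    "('k::field \<Rightarrow> 'm::ab_group_add \<Rightarrow> 'm) \<Rightarrow> 'm complex_data \<Rightarrow> 'm complex_data \<Rightarrow>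
     (int \<Rightarrow> 'm \<Rightarrow> 'm) \<Rightarrow> bool" where
  "is_quasi_isomorphism s C D f \<longleftrightarrow>
     is_chain_map s C D f \<and>
     (\<forall>k. bij_betw (homology_map D f k) (homology C k) (homology D k))"

text \<open>Two complexes are quasi-isomorphic if a finite zig-zag of quasi-isomorphisms connects them
  (here with all complexes of the zig-zag in the same ambient space).\<close>

definition quasi_isomorphic ::
    "('k::field \<Rightarrow> 'm::ab_group_add \<Rightarrow> 'm) \<Rightarrow> 'm complex_data \<Rightarrow> 'm complex_data \<Rightarrow> bool" where
  "quasi_isomorphic s = equivclp (\<lambda>C D.
     is_chain_complex s C \<and> is_chain_complex s D \<and> (\<exists>f. is_quasi_isomorphism s C D f))"

section \<open>The chain complex of a cosheaf\<close>

definition fun_scale :: "('k \<Rightarrow> 'a \<Rightarrow> 'a) \<Rightarrow> 'k \<Rightarrow> ('i \<Rightarrow> 'a) \<Rightarrow> 'i \<Rightarrow> 'a" where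
  "fun_scale scale c f = (\<lambda>i. scale c (f i))"

definition direct_sum :: "'i set \<Rightarrow> ('i \<Rightarrow> 'a::zero set) \<Rightarrow> ('i \<Rightarrow> 'a) set" where
  "direct_sum I V = {f. (\<forall>i\<in>I. f i \<in> V i) \<and> (\<forall>i. i \<notin> I \<longrightarrow> f i = 0)}"

text \<open>The map between direct sums over finite \<open>I\<close> and \<open>J\<close> with block \<open>b i j\<close> from summand \<open>i\<close>
  to summand \<open>j\<close>.\<close>

definition block_map ::
    "'i set \<Rightarrow> 'i set \<Rightarrow> ('i \<Rightarrow> 'i \<Rightarrow> 'a \<Rightarrow> 'a) \<Rightarrow> ('i \<Rightarrow> 'a::ab_group_add) \<Rightarrow> 'i \<Rightarrow> 'a" where
  "block_map I J b f = (\<lambda>j. if j \<in> J then \<Sum>i\<in>I. b i j (f i) else 0)"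

definition cosheaf_block ::
    "('k::field \<Rightarrow> 'a \<Rightarrow> 'a) \<Rightarrow> ('v set \<Rightarrow> 'v rel) \<Rightarrow> ('v set \<Rightarrow> 'v set \<Rightarrow> 'a \<Rightarrow> 'a) \<Rightarrow>
     'v set \<Rightarrow> 'v set \<Rightarrow> 'a \<Rightarrow> 'a" where
  "cosheaf_block scale ord ext \<sigma> \<tau> x = scale (of_int (incidence ord \<sigma> \<tau>)) (ext \<sigma> \<tau> x)"

definition cosheaf_complex ::
    "('k::field \<Rightarrow> 'a::ab_group_add \<Rightarrow> 'a) \<Rightarrow> 'v set set \<Rightarrow> ('v set \<Rightarrow> 'v rel) \<Rightarrow>
     ('v set \<Rightarrow> 'a set) \<Rightarrow> ('v set \<Rightarrow> 'v set \<Rightarrow> 'a \<Rightarrow> 'a) \<Rightarrow> ('v set \<Rightarrow> 'a) complex_data" where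
  "cosheaf_complex scale K ord St ext =
     \<lparr>chains = \<lambda>k. direct_sum (simplices_of_dim K k) St,
      bd = \<lambda>k. block_map (simplices_of_dim K k) (simplices_of_dim K (k - 1))
                 (cosheaf_block scale ord ext)\<rparr>"

section \<open>Acyclic partial matchings and the Morse complex\<close>

definition partial_matching :: "'v set set \<Rightarrow> ('v set \<times> 'v set) set \<Rightarrow> bool" where
  "partial_matching K M \<longleftrightarrow>
     (\<forall>(\<sigma>, \<tau>)\<in>M. \<sigma> \<in> K \<and> \<tau> \<in> K \<and> codim_one_face \<sigma> \<tau>) \<and>
     (\<forall>p\<in>M. \<forall>q\<in>M. {fst p, snd p} \<inter> {fst q, snd q} \<noteq> {} \<longrightarrow> p = q)"

definition critical :: "'v set set \<Rightarrow> ('v set \<times> 'v set) set \<Rightarrow> 'v set set" where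
  "critical K M = {\<alpha> \<in> K. \<forall>p\<in>M. \<alpha> \<noteq> fst p \<and> \<alpha> \<noteq> snd p}"

text \<open>The path \<open>\<sigma>\<^sub>1 \<lhd> \<tau>\<^sub>1 \<rhd> \<dots> \<rhd> \<sigma>\<^sub>m \<lhd> \<tau>\<^sub>m\<close> is encoded as the list
  \<open>[(\<sigma>\<^sub>1, \<tau>\<^sub>1), \<dots>, (\<sigma>\<^sub>m, \<tau>\<^sub>m)]\<close>.\<close>

definition is_path :: "('v set \<times> 'v set) set \<Rightarrow> ('v set \<times> 'v set) list \<Rightarrow> bool" where
  "is_path M \<rho> \<longleftrightarrow>
     \<rho> \<noteq> [] \<and> set \<rho> \<subseteq> M \<and> distinct (map fst \<rho> @ map snd \<rho>) \<and>
     (\<forall>i. Suc i < length \<rho> \<longrightarrow> codim_one_face (fst (\<rho> ! Suc i)) (snd (\<rho> ! i)))"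

definition is_gradient :: "('v set \<times> 'v set) list \<Rightarrow> bool" where
  "is_gradient \<rho> \<longleftrightarrow> length \<rho> = 1 \<or> \<not> fst (hd \<rho>) \<subseteq> snd (last \<rho>)"

definition acyclic_partial_matching :: "'v set set \<Rightarrow> ('v set \<times> 'v set) set \<Rightarrow> bool" where
  "acyclic_partial_matching K M \<longleftrightarrow>
     partial_matching K M \<and> (\<forall>\<rho>. is_path M \<rho> \<longrightarrow> is_gradient \<rho>)"

text \<open>For a cosheaf the maps \<open>ext \<tau> \<sigma>\<close> are linear, so bijectivity makes them isomorphisms.\<close>

definition compatible_matching ::
    "('v set \<Rightarrow> 'a set) \<Rightarrow> ('v set \<Rightarrow> 'v set \<Rightarrow> 'a \<Rightarrow> 'a) \<Rightarrow> ('v set \<times> 'v set) set \<Rightarrow> bool" where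
  "compatible_matching St ext M \<longleftrightarrow> (\<forall>(\<sigma>, \<tau>)\<in>M. bij_betw (ext \<tau> \<sigma>) (St \<tau>) (St \<sigma>))"

fun path_map ::
    "('v set \<Rightarrow> 'a set) \<Rightarrow> ('v set \<Rightarrow> 'v set \<Rightarrow> 'a \<Rightarrow> 'a) \<Rightarrow> ('v set \<times> 'v set) list \<Rightarrow> 'a \<Rightarrow> 'a"
  where
    "path_map St ext [] = id"
  | "path_map St ext [(\<sigma>, \<tau>)] = inv_into (St \<tau>) (ext \<tau> \<sigma>)"
  | "path_map St ext ((\<sigma>, \<tau>) # (\<sigma>', \<tau>') # \<rho>) =
       path_map St ext ((\<sigma>', \<tau>') # \<rho>) \<circ> ext \<tau> \<sigma>' \<circ> inv_into (St \<tau>) (ext \<tau> \<sigma>)"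

definition path_sign :: "('v set \<Rightarrow> 'v rel) \<Rightarrow> ('v set \<times> 'v set) list \<Rightarrow> int" where
  "path_sign ord \<rho> =
     (-1) ^ length \<rho> *
     (\<Prod>i<length \<rho>. incidence ord (snd (\<rho> ! i)) (fst (\<rho> ! i))) *
     (\<Prod>i<length \<rho> - 1. incidence ord (snd (\<rho> ! i)) (fst (\<rho> ! Suc i)))"

definition path_weight ::
    "('k::field \<Rightarrow> 'a \<Rightarrow> 'a) \<Rightarrow> ('v set \<Rightarrow> 'v rel) \<Rightarrow> ('v set \<Rightarrow> 'a set) \<Rightarrow>
     ('v set \<Rightarrow> 'v set \<Rightarrow> 'a \<Rightarrow> 'a) \<Rightarrow> ('v set \<times> 'v set) list \<Rightarrow> 'a \<Rightarrow> 'a" where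
  "path_weight scale ord St ext \<rho> x = scale (of_int (path_sign ord \<rho>)) (path_map St ext \<rho> x)"

text \<open>Both incidence symbols of a summand are collected in one scalar in front, so that a summand
  vanishes when either symbol does, whatever the values of the accompanying maps. The sum is over
  a finite set when the matching is finite, since the pairs of a path are distinct.\<close>

definition morse_block ::
    "('k::field \<Rightarrow> 'a::ab_group_add \<Rightarrow> 'a) \<Rightarrow> ('v set \<Rightarrow> 'v rel) \<Rightarrow> ('v set \<Rightarrow> 'a set) \<Rightarrow>
     ('v set \<Rightarrow> 'v set \<Rightarrow> 'a \<Rightarrow> 'a) \<Rightarrow> ('v set \<times> 'v set) set \<Rightarrow> 'v set \<Rightarrow> 'v set \<Rightarrow> 'a \<Rightarrow> 'a" where
  "morse_block scale ord St ext M \<alpha> \<omega> x =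
     scale (of_int (incidence ord \<alpha> \<omega>)) (ext \<alpha> \<omega> x) +
     (\<Sum>\<rho>\<in>{\<rho>. is_path M \<rho>}.
        let \<sigma> = fst (hd \<rho>); \<tau> = snd (last \<rho>) in
        scale (of_int (incidence ord \<tau> \<omega> * incidence ord \<alpha> \<sigma>))
          (ext \<tau> \<omega> (path_weight scale ord St ext \<rho> (ext \<alpha> \<sigma> x))))"

definition morse_complex ::
    "('k::field \<Rightarrow> 'a::ab_group_add \<Rightarrow> 'a) \<Rightarrow> 'v set set \<Rightarrow> ('v set \<Rightarrow> 'v rel) \<Rightarrow>
     ('v set \<Rightarrow> 'a set) \<Rightarrow> ('v set \<Rightarrow> 'v set \<Rightarrow> 'a \<Rightarrow> 'a) \<Rightarrow> ('v set \<times> 'v set) set \<Rightarrow>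
     ('v set \<Rightarrow> 'a) complex_data" where
  "morse_complex scale K ord St ext M =
     \<lparr>chains = \<lambda>k. direct_sum (critical K M \<inter> simplices_of_dim K k) St,
      bd = \<lambda>k. block_map (critical K M \<inter> simplices_of_dim K k)
                 (critical K M \<inter> simplices_of_dim K (k - 1))
                 (morse_block scale ord St ext M)\<rparr>"

end

theory Submission
  imports Defs
begin

text \<open>Gaussian elimination explains the theorem. Forgetting the grading, let \<open>V\<close> be the direct sum of
  all stalks, with boundary \<open>d\<close>. It splits into the stalks over the critical simplices (\<open>A\<close>), those
  over the lower simplices of the matched pairs (\<open>S\<close>) and those over the upper ones (\<open>T\<close>). If the
  block \<open>T \<rightarrow> S\<close> of \<open>d\<close> is invertible, with inverse \<open>h\<close> extended by zero to \<open>V\<close>, then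
  \<open>\<pi> = 1 - d h - h d\<close> is an idempotent chain map that is homotopic to the identity, kills \<open>T\<close> and has
  no component in \<open>S\<close>. Hence \<open>\<pi> e \<pi> = \<pi>\<close> for the projection \<open>e\<close> onto \<open>A\<close>. This single identity gives
  everything at once: \<open>\<delta> = e (d - d h d)\<close> is a differential on \<open>A\<close>, the map \<open>1 - h d\<close> from \<open>A\<close> to \<open>V\<close>
  and the map \<open>e \<pi>\<close> back are chain maps, their composite on \<open>A\<close> is the identity, and their
  composite on \<open>V\<close> is \<open>\<pi>\<close>. This is \<open>reduced_complex_quasi_isomorphic\<close>.

  Acyclicity provides the inverse. The block \<open>T \<rightarrow> S\<close> is \<open>m + r\<close>, where \<open>m\<close> collects the maps of the
  matched pairs, invertible by compatibility, and \<open>r\<close> the remaining incidences. Its inverse is the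
  Neumann series \<open>m\<^sup>-\<^sup>1 - m\<^sup>-\<^sup>1 r m\<^sup>-\<^sup>1 + \<dots>\<close>, whose terms are the zig-zags of matched pairs; these are
  the negatives of the path weights. A zig-zag cannot return to a pair that it has left, since it
  would then contain a path that is not gradient. So the zig-zags are the paths, the series is
  finite, and prolonging a path at either end is a matter of the adjacent pair only
  (\<open>is_path_Cons\<close>, \<open>is_path_snoc\<close>). Prolongation reverses the sign of a path's contribution to \<open>h d\<close>
  or \<open>d h\<close>; everything cancels but the paths with one pair, which make up the identity
  (\<open>path_operator_left_inverse\<close>, \<open>path_operator_right_inverse\<close>). Substituting the sum over paths
  for \<open>- h\<close> in \<open>\<delta>\<close> gives the boundary of the Morse complex, block by block (\<open>reduced_bd\<close>).\<close>

section \<open>Linear maps between subspaces\<close>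

context vector_space
begin

lemma linear_between_mem: "linear_between scale scale V W f \<Longrightarrow> x \<in> V \<Longrightarrow> f x \<in> W"
  and linear_between_add:
    "linear_between scale scale V W f \<Longrightarrow> x \<in> V \<Longrightarrow> y \<in> V \<Longrightarrow> f (x + y) = f x + f y"
  and linear_between_scale:
    "linear_between scale scale V W f \<Longrightarrow> x \<in> V \<Longrightarrow> f (scale c x) = scale c (f x)"
  by (auto simp: linear_between_def)

lemma linear_between_zero:
  assumes "linear_between scale scale V W f" "subspace V" shows "f 0 = 0"
  using linear_between_scale[OF assms(1) subspace_0[OF assms(2)], of 0] by simp

lemma linear_between_minus:
  assumes "linear_between scale scale V W f" "x \<in> V" shows "f (- x) = - f x"
  using linear_between_scale[OF assms, of "-1"] by simp

lemma linear_between_diff: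
  assumes "linear_between scale scale V W f" "subspace V" "x \<in> V" "y \<in> V"
  shows "f (x - y) = f x - f y"
  using linear_between_add[OF assms(1,3) subspace_neg[OF assms(2,4)]]
    linear_between_minus[OF assms(1,4)] by simp

lemma linear_between_sum:
  assumes "linear_between scale scale V W f" "subspace V" "\<And>i. i \<in> I \<Longrightarrow> x i \<in> V"
  shows "f (\<Sum>i\<in>I. x i) = (\<Sum>i\<in>I. f (x i))"
  using assms(3)
proof (induction I rule: infinite_finite_induct)
  case (insert i I)
  then show ?case
    using linear_between_add[OF assms(1), of "x i" "sum x I"] subspace_sum[OF assms(2), of I x]
    by auto
qed (use linear_between_zero[OF assms(1,2)] in auto)

lemma linear_between_compose:
  "linear_between scale scale U V f \<Longrightarrow> linear_between scale scale V W g \<Longrightarrow>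
   linear_between scale scale U W (\<lambda>x. g (f x))"
  by (auto simp: linear_between_def)

lemma linear_between_cmul:
  "linear_between scale scale V W f \<Longrightarrow> subspace W \<Longrightarrow>
   linear_between scale scale V W (\<lambda>x. scale a (f x))"
  by (auto simp: linear_between_def scale_right_distrib subspace_scale scale_left_commute)

lemma linear_between_subtract:
  "linear_between scale scale V W f \<Longrightarrow> linear_between scale scale V W g \<Longrightarrow> subspace W \<Longrightarrow>
   linear_between scale scale V W (\<lambda>x. f x - g x)"
  by (auto simp: linear_between_def scale_right_diff_distrib subspace_diff)

lemma linear_between_inv_into:
  assumes f: "linear_between scale scale V W f" and V: "subspace V" and b: "bij_betw f V W"
  shows "linear_between scale scale W V (inv_into V f)"
proof -
  have inv: "inv_into V f y \<in> V" "f (inv_into V f y) = y" if "y \<in> W" for y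
    using b that by (auto simp: bij_betw_def inv_into_into f_inv_into_f)
  have inv': "inv_into V f (f x) = x" if "x \<in> V" for x
    using b that by (auto simp: bij_betw_def)
  have "inv_into V f (x + y) = inv_into V f x + inv_into V f y" if "x \<in> W" "y \<in> W" for x y
    using inv'[OF subspace_add[OF V inv(1) inv(1)], OF that]
    by (simp add: linear_between_add[OF f] inv that)
  moreover have "inv_into V f (scale c x) = scale c (inv_into V f x)" if "x \<in> W" for c x
    using inv'[OF subspace_scale[OF V inv(1)], OF that]
    by (simp add: linear_between_scale[OF f] inv that)
  ultimately show ?thesis
    using inv(1) by (simp add: linear_between_def)
qed

end

section \<open>Deformation retracts and quasi-isomorphisms\<close>

context vector_space
begin

lemma boundaries_subspace:
  assumes "is_chain_complex scale C" shows "subspace (boundaries C k)"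
proof -
  have l: "linear_between scale scale (chains C (k + 1)) (chains C (k + 1 - 1)) (bd C (k + 1))"
    and s: "subspace (chains C (k + 1))"
    using assms unfolding is_chain_complex_def by blast+
  show ?thesis
  proof (rule subspaceI)
    show "0 \<in> boundaries C k"
      unfolding boundaries_def
      using linear_between_zero[OF l s] by (rule image_eqI[OF sym subspace_0[OF s]])
  next
    fix x y assume "x \<in> boundaries C k" "y \<in> boundaries C k"
    then show "x + y \<in> boundaries C k"
      unfolding boundaries_def
      by (auto simp: linear_between_add[OF l, symmetric] subspace_add[OF s])
  next
    fix c x assume "x \<in> boundaries C k"
    then show "scale c x \<in> boundaries C k"
      unfolding boundaries_def
      by (auto simp: linear_between_scale[OF l, symmetric] subspace_scale[OF s])
  qed
qed

lemma homologous_equiv: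
  assumes "is_chain_complex scale C"
  shows "equiv (cycles C k)
    {(x, y). x \<in> cycles C k \<and> y \<in> cycles C k \<and> x - y \<in> boundaries C k}"
proof (rule equivI)
  let ?B = "boundaries C k"
  have B: "subspace ?B" by (rule boundaries_subspace[OF assms])
  show "sym {(x, y). x \<in> cycles C k \<and> y \<in> cycles C k \<and> x - y \<in> ?B}"
    using subspace_neg[OF B] by (force intro!: symI)
  show "trans {(x, y). x \<in> cycles C k \<and> y \<in> cycles C k \<and> x - y \<in> ?B}"
    using subspace_add[OF B] by (force intro!: transI)
  show "refl_on (cycles C k) {(x, y). x \<in> cycles C k \<and> y \<in> cycles C k \<and> x - y \<in> ?B}"
    using subspace_0[OF B] by (auto simp: refl_on_def)
qed (auto)

lemma chain_map_cycles:
  assumes "is_chain_map scale C D g" "is_chain_complex scale C" "x \<in> cycles C k"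
  shows "g k x \<in> cycles D k"
proof -
  have l: "linear_between scale scale (chains C (k - 1)) (chains D (k - 1)) (g (k - 1))"
    and l': "linear_between scale scale (chains C k) (chains D k) (g k)"
    and s: "subspace (chains C (k - 1))"
    and c: "\<forall>x\<in>chains C k. g (k - 1) (bd C k x) = bd D k (g k x)"
    using assms by (auto simp: is_chain_map_def is_chain_complex_def)
  show ?thesis
    using assms(3) c linear_between_mem[OF l'] linear_between_zero[OF l s]
    by (fastforce simp: cycles_def)
qed

lemma chain_map_boundaries:
  assumes "is_chain_map scale C D g" "x \<in> boundaries C k"
  shows "g k x \<in> boundaries D k"
proof -
  obtain y where y: "y \<in> chains C (k + 1)" "x = bd C (k + 1) y"
    using assms(2) by (auto simp: boundaries_def)
  have "g (k + 1 - 1) (bd C (k + 1) y) = bd D (k + 1) (g (k + 1) y)"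
    and "g (k + 1) y \<in> chains D (k + 1)"
    using assms(1) y(1) unfolding is_chain_map_def linear_between_def by blast+
  then show ?thesis using y by (auto simp: boundaries_def)
qed

lemma homology_map_class:
  assumes C: "is_chain_complex scale C" and D: "is_chain_complex scale D"
    and g: "is_chain_map scale C D g" and x: "x \<in> cycles C k"
  shows "homology_map D g k
      ({(x, y). x \<in> cycles C k \<and> y \<in> cycles C k \<and> x - y \<in> boundaries C k} `` {x}) =
    {(x, y). x \<in> cycles D k \<and> y \<in> cycles D k \<and> x - y \<in> boundaries D k} `` {g k x}"
proof -
  have B: "subspace (boundaries D k)" by (rule boundaries_subspace[OF D])
  have l: "linear_between scale scale (chains C k) (chains D k) (g k)"
    and s: "subspace (chains C k)"
    using g C by (auto simp: is_chain_map_def is_chain_complex_def)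
  have hom: "g k x - g k x' \<in> boundaries D k"
    if "x' \<in> cycles C k" "x - x' \<in> boundaries C k" for x'
  proof -
    have "g k (x - x') = g k x - g k x'"
      using that(1) x by (intro linear_between_diff[OF l s]) (auto simp: cycles_def)
    then show ?thesis using chain_map_boundaries[OF g that(2)] by simp
  qed
  have "g k x - y \<in> boundaries D k"
    if "x' \<in> cycles C k" "x - x' \<in> boundaries C k" "g k x' - y \<in> boundaries D k" for x' y
    using subspace_add[OF B hom[OF that(1,2)] that(3)] by simp
  moreover have "x - x \<in> boundaries C k"
    using subspace_0[OF boundaries_subspace[OF C]] by simp
  ultimately show ?thesis
    using x chain_map_cycles[OF g C x] unfolding homology_map_def by blast
qed

text \<open>A left inverse makes the induced map injective on homology, and a homotopy from the other
  composite to the identity makes every class of the large complex an image.\<close>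

proposition deformation_retract_quasi_isomorphism:
  assumes C: "is_chain_complex scale C" and D: "is_chain_complex scale D"
    and g: "is_chain_map scale C D g" and f: "is_chain_map scale D C f"
    and fg: "\<And>k x. x \<in> chains C k \<Longrightarrow> f k (g k x) = x"
    and h_mem: "\<And>k x. x \<in> chains D k \<Longrightarrow> h k x \<in> chains D (k + 1)"
    and h_zero: "\<And>k. h k 0 = 0"
    and gf: "\<And>k x. x \<in> chains D k \<Longrightarrow>
      x - g k (f k x) = bd D (k + 1) (h k x) + h (k - 1) (bd D k x)"
  shows "is_quasi_isomorphism scale C D g"
  unfolding is_quasi_isomorphism_def
proof (intro conjI allI g)
  fix k
  let ?R = "{(x, y). x \<in> cycles C k \<and> y \<in> cycles C k \<and> x - y \<in> boundaries C k}"
  let ?S = "{(x, y). x \<in> cycles D k \<and> y \<in> cycles D k \<and> x - y \<in> boundaries D k}"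
  have class_image: "homology_map D g k (?R `` {x}) = ?S `` {g k x}" if "x \<in> cycles C k" for x
    by (rule homology_map_class[OF C D g that])
  have lf: "linear_between scale scale (chains D k) (chains C k) (f k)"
    and sD: "subspace (chains D k)"
    using f D by (auto simp: is_chain_map_def is_chain_complex_def)
  show "bij_betw (homology_map D g k) (homology C k) (homology D k)"
    unfolding bij_betw_def
  proof
    show "inj_on (homology_map D g k) (homology C k)"
    proof (rule inj_onI)
      fix X Y assume "X \<in> homology C k" and "Y \<in> homology C k"
        and eq: "homology_map D g k X = homology_map D g k Y"
      then obtain x y where x: "x \<in> cycles C k" "X = ?R `` {x}"
        and y: "y \<in> cycles C k" "Y = ?R `` {y}"
        by (auto simp: homology_def quotient_def)
      have gx: "g k x \<in> cycles D k" and gy: "g k y \<in> cycles D k"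
        using chain_map_cycles[OF g C] x y by auto
      have "?S `` {g k x} = ?S `` {g k y}" using eq x y class_image by simp
      then have "(g k x, g k y) \<in> ?S"
        using eq_equiv_class[OF _ homologous_equiv[OF D]] gy by blast
      then have "f k (g k x - g k y) \<in> boundaries C k"
        by (intro chain_map_boundaries[OF f]) auto
      moreover have "f k (g k x - g k y) = x - y"
        using linear_between_diff[OF lf sD, of "g k x" "g k y"] gx gy x(1) y(1) fg
        by (auto simp: cycles_def)
      ultimately have "(x, y) \<in> ?R" using x(1) y(1) by simp
      then show "X = Y"
        unfolding x(2) y(2) by (rule equiv_class_eq[OF homologous_equiv[OF C]])
    qed
    show "homology_map D g k ` homology C k = homology D k"
    proof
      show "homology_map D g k ` homology C k \<subseteq> homology D k"
      proof (rule image_subsetI)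
        fix X assume "X \<in> homology C k"
        then obtain x where x: "x \<in> cycles C k" "X = ?R `` {x}"
          unfolding homology_def by (rule quotientE)
        show "homology_map D g k X \<in> homology D k"
          unfolding x(2) class_image[OF x(1)] homology_def
          by (rule quotientI[OF chain_map_cycles[OF g C x(1)]])
      qed
      show "homology D k \<subseteq> homology_map D g k ` homology C k"
      proof
        fix Y assume "Y \<in> homology D k"
        then obtain y where y: "y \<in> cycles D k" "Y = ?S `` {y}"
          by (auto simp: homology_def quotient_def)
        have fy: "f k y \<in> cycles C k" by (rule chain_map_cycles[OF f D y(1)])
        have "y - g k (f k y) \<in> boundaries D k"
          using y(1) gf[of y k] h_mem[of y k] h_zero by (auto simp: cycles_def boundaries_def)
        then have "(y, g k (f k y)) \<in> ?S"
          using y(1) chain_map_cycles[OF g C fy] by auto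
        then have "Y = homology_map D g k (?R `` {f k y})"
          unfolding class_image[OF fy] y(2) by (rule equiv_class_eq[OF homologous_equiv[OF D]])
        then show "Y \<in> homology_map D g k ` homology C k"
          unfolding homology_def by (rule image_eqI) (rule quotientI[OF fy])
      qed
    qed
  qed
qed

end

section \<open>Algebraic discrete Morse theory\<close>

text \<open>The space \<open>V\<close> is a direct sum \<open>A \<oplus> S \<oplus> T\<close> with projections \<open>eA\<close>, \<open>eS\<close>, \<open>eT\<close>, and the block
  \<open>T \<rightarrow> S\<close> of the differential \<open>d\<close> is invertible. The map \<open>h\<close> is its inverse \<open>S \<rightarrow> T\<close>, extended by
  zero. Grading is ignored at this stage, so that compositions do not have to carry degrees.\<close>

locale block_contraction = vector_space scale
  for scale :: "'k::field \<Rightarrow> 'm::ab_group_add \<Rightarrow> 'm" +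
  fixes V :: "'m set" and d h eA eS eT :: "'m \<Rightarrow> 'm"
  assumes V: "subspace V"
    and d_linear: "linear_between scale scale V V d"
    and h_linear: "linear_between scale scale V V h"
    and eA_linear: "linear_between scale scale V V eA"
    and eS_linear: "linear_between scale scale V V eS"
    and eT_linear: "linear_between scale scale V V eT"
    and d_d: "x \<in> V \<Longrightarrow> d (d x) = 0"
    and decomp: "x \<in> V \<Longrightarrow> x = eA x + eS x + eT x"
    and eA_h: "x \<in> V \<Longrightarrow> eA (h x) = 0"
    and eS_h: "x \<in> V \<Longrightarrow> eS (h x) = 0"
    and h_eA: "x \<in> V \<Longrightarrow> h (eA x) = 0"
    and h_eT: "x \<in> V \<Longrightarrow> h (eT x) = 0"
    and h_right_inverse: "x \<in> V \<Longrightarrow> eS (d (h x)) = eS x"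
    and h_left_inverse: "x \<in> V \<Longrightarrow> h (d (eT x)) = eT x"
begin

lemmas closed [simp] =
  linear_between_mem[OF d_linear] linear_between_mem[OF h_linear]
  linear_between_mem[OF eA_linear] linear_between_mem[OF eS_linear]
  linear_between_mem[OF eT_linear]
  subspace_diff[OF V] subspace_add[OF V] subspace_0[OF V]

lemmas distrib =
  linear_between_diff[OF d_linear V] linear_between_diff[OF h_linear V]
  linear_between_diff[OF eA_linear V] linear_between_diff[OF eS_linear V]
  linear_between_diff[OF eT_linear V]
  linear_between_add[OF h_linear]
  linear_between_zero[OF d_linear V] linear_between_zero[OF h_linear V]
  linear_between_zero[OF eA_linear V]

lemma h_h: "h (h x) = 0" if "x \<in> V"
  using that decomp[of "h x"] h_eT[of "h x"] by (simp add: eA_h eS_h)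

lemma h_eS: "h (eS x) = h x" if "x \<in> V"
proof -
  have "h (eA x + eS x + eT x) = h (eS x)" using that by (simp add: distrib h_eA h_eT)
  then show ?thesis using decomp[OF that] by simp
qed

lemma h_d_h: "h (d (h x)) = h x" if "x \<in> V"
  using that h_eS[of "d (h x)"] by (simp add: h_right_inverse h_eS)

text \<open>Subtracting the homotopy \<open>d h + h d\<close> from the identity gives a chain endomorphism, and it is
  idempotent because \<open>h h = 0\<close> and \<open>h d h = h\<close>. Its image is a subcomplex homotopy equivalent to
  the whole complex.\<close>

definition \<pi> :: "'m \<Rightarrow> 'm" where "\<pi> x = x - d (h x) - h (d x)"

lemma \<pi>_closed [simp]: "x \<in> V \<Longrightarrow> \<pi> x \<in> V"
  by (simp add: \<pi>_def)

lemma d_\<pi>: "d (\<pi> x) = \<pi> (d x)" if "x \<in> V"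
  using that by (simp add: \<pi>_def distrib d_d)

lemma \<pi>_\<pi>: "\<pi> (\<pi> x) = \<pi> x" if "x \<in> V"
proof -
  have "h (\<pi> y) = 0" if "y \<in> V" for y
    using that by (simp add: \<pi>_def distrib h_d_h h_h)
  then show ?thesis using that by (simp add: \<pi>_def[of "\<pi> x"] distrib d_\<pi>)
qed

text \<open>The projection kills the summand \<open>T\<close> because \<open>h d\<close> is the identity there, and its image has
  no component in \<open>S\<close> because \<open>d h\<close> is the identity modulo the other summands; so nothing is lost
  by passing through \<open>A\<close>.\<close>

lemma \<pi>_eA_\<pi>: "\<pi> (eA (\<pi> x)) = \<pi> x" if x: "x \<in> V"
proof -
  have "eS (\<pi> x) = 0"
  proof -
    have "eS (h (d x)) = 0" using x by (simp add: eS_h)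
    then show ?thesis using x by (simp add: \<pi>_def distrib h_right_inverse)
  qed
  then have "eA (\<pi> x) = \<pi> x - eT (\<pi> x)"
    using decomp[of "\<pi> x"] x by (simp add: algebra_simps)
  moreover have "\<pi> (eT (\<pi> x)) = 0"
    using x by (simp add: \<pi>_def[of "eT (\<pi> x)"] h_eT h_left_inverse distrib)
  moreover have "\<pi> (y - z) = \<pi> y - \<pi> z" if "y \<in> V" "z \<in> V" for y z
    using that by (simp add: \<pi>_def distrib)
  ultimately show ?thesis using x by (simp add: \<pi>_\<pi>)
qed

lemma eA_\<pi>: "eA (\<pi> x) = x" if "x \<in> V" "eA x = x"
proof -
  have "h x = 0" using that h_eA[of x] by simp
  then show ?thesis using that by (simp add: \<pi>_def distrib eA_h)
qed

lemma \<pi>_on_A: "\<pi> x = x - h (d x)" if "x \<in> V" "eA x = x"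
  using that h_eA[of x] by (simp add: \<pi>_def distrib)

text \<open>By \<open>\<pi> eA \<pi> = \<pi>\<close>, the maps \<open>\<pi>\<close> from \<open>A\<close> and \<open>eA \<pi>\<close> to \<open>A\<close> identify \<open>A\<close> with the image of \<open>\<pi>\<close>,
  and the differential of that image becomes \<open>eA d \<pi> = eA (d - d h d)\<close> on \<open>A\<close>. The homotopy between
  the composite on the large complex and the identity is \<open>h\<close> itself.\<close>

theorem reduced_complex_quasi_isomorphic:
  assumes C: "is_chain_complex scale C"
    and C_sub: "\<And>k. chains C k \<subseteq> V"
    and C_bd: "\<And>k x. x \<in> chains C k \<Longrightarrow> bd C k x = d x"
    and C_h: "\<And>k x. x \<in> chains C k \<Longrightarrow> h x \<in> chains C (k + 1)"
    and C_eA: "\<And>k x. x \<in> chains C k \<Longrightarrow> eA x \<in> chains C k"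
    and eA_eA: "\<And>x. x \<in> V \<Longrightarrow> eA (eA x) = eA x"
    and M_chains: "\<And>k. chains M k = {x \<in> chains C k. eA x = x}"
    and M_bd: "\<And>k x. x \<in> chains M k \<Longrightarrow> bd M k x = eA (d x) - eA (d (h (d x)))"
  shows "is_chain_complex scale M"
    and "is_quasi_isomorphism scale M C (\<lambda>k x. x - h (d x))"
proof -
  have in_V: "x \<in> V" if "x \<in> chains C k" for x k using C_sub that by blast
  have C_sp: "subspace (chains C k)" for k using C by (auto simp: is_chain_complex_def)
  have C_d: "d x \<in> chains C (k - 1)" if "x \<in> chains C k" for x k
    using C C_bd that by (fastforce simp: is_chain_complex_def linear_between_def)
  have C_hd: "h (d x) \<in> chains C k" if "x \<in> chains C k" for x k
    using C_h[OF C_d[OF that]] by simp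
  have C_dh: "d (h x) \<in> chains C k" if "x \<in> chains C k" for x k
    using C_d[OF C_h[OF that]] by simp
  have C_\<pi>: "\<pi> x \<in> chains C k" if "x \<in> chains C k" for x k
    unfolding \<pi>_def using that by (intro subspace_diff[OF C_sp] C_hd C_dh)
  have lin: "linear_between scale scale X Y F"
    if "linear_between scale scale V V F" "X \<subseteq> V" "\<And>x. x \<in> X \<Longrightarrow> F x \<in> Y" for X Y F
    using that unfolding linear_between_def by (meson subset_iff)
  have id_linear: "linear_between scale scale V V (\<lambda>x. x)"
    by (simp add: linear_between_def)
  have \<pi>_linear: "linear_between scale scale V V \<pi>"
    unfolding \<pi>_def
    by (intro linear_between_subtract V linear_between_compose[OF d_linear h_linear]
        linear_between_compose[OF h_linear d_linear] id_linear)
  have M_V: "x \<in> V" "eA x = x" "x \<in> chains C k" if "x \<in> chains M k" for x k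
    using that in_V M_chains by auto
  have M_bd_\<pi>: "bd M k x = eA (\<pi> (d x))" if "x \<in> chains M k" for x k
    using M_V[OF that] by (simp add: M_bd[OF that] \<pi>_def distrib d_d)
  have M_mem: "eA (\<pi> x) \<in> chains M k" if "x \<in> chains C k" for x k
    using C_eA[OF C_\<pi>[OF that]] in_V[OF that] by (simp add: M_chains eA_eA)
  have M_sp: "subspace (chains M k)" for k
    unfolding M_chains
    by (rule subspaceI)
      (auto intro: subspace_0[OF C_sp] subspace_add[OF C_sp] subspace_scale[OF C_sp] simp: distrib
        linear_between_add[OF eA_linear in_V in_V] linear_between_scale[OF eA_linear in_V])
  have M_bd_linear: "linear_between scale scale (chains M k) (chains M (k - 1)) (bd M k)" for k
  proof -
    have "linear_between scale scale (chains M k) (chains M (k - 1)) (\<lambda>x. eA (\<pi> (d x)))"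
      using M_V(1) M_mem[OF C_d[OF M_V(3)]]
      by (intro lin[OF linear_between_compose[OF d_linear
            linear_between_compose[OF \<pi>_linear eA_linear]]]) auto
    then show ?thesis
      by (simp add: linear_between_def M_bd_\<pi> subspace_add[OF M_sp] subspace_scale[OF M_sp])
  qed
  have M_bd_bd: "bd M (k - 1) (bd M k x) = 0" if x: "x \<in> chains M k" for k x
  proof -
    have xV: "x \<in> V" using M_V[OF x] by simp
    have m: "eA (\<pi> (d x)) \<in> chains M (k - 1)" by (rule M_mem[OF C_d[OF M_V(3)[OF x]]])
    have "bd M (k - 1) (bd M k x) = eA (\<pi> (d (eA (\<pi> (d x)))))"
      using M_bd_\<pi>[OF m] M_bd_\<pi>[OF x] by simp
    also have "\<dots> = eA (d (\<pi> (eA (\<pi> (d x)))))" using xV by (simp add: d_\<pi>)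
    also have "\<dots> = 0" using xV by (simp add: \<pi>_eA_\<pi> d_\<pi> d_d) (simp add: \<pi>_def distrib)
    finally show ?thesis .
  qed
  show M: "is_chain_complex scale M"
    unfolding is_chain_complex_def using M_sp M_bd_linear M_bd_bd by blast
  show "is_quasi_isomorphism scale M C (\<lambda>k x. x - h (d x))"
  proof (rule deformation_retract_quasi_isomorphism[where f = "\<lambda>k x. eA (\<pi> x)" and h = "\<lambda>k. h"])
    show "is_chain_map scale M C (\<lambda>k x. x - h (d x))"
      unfolding is_chain_map_def
    proof (intro conjI allI ballI)
      fix k
      show "linear_between scale scale (chains M k) (chains C k) (\<lambda>x. x - h (d x))"
        using M_V(1) subspace_diff[OF C_sp M_V(3) C_hd[OF M_V(3)]]
        by (intro lin[OF linear_between_subtract[OF id_linear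
              linear_between_compose[OF d_linear h_linear] V]]) auto
      fix x assume x: "x \<in> chains M k"
      have xV: "x \<in> V" using M_V[OF x] by simp
      have m: "eA (\<pi> (d x)) \<in> chains M (k - 1)" by (rule M_mem[OF C_d[OF M_V(3)[OF x]]])
      have "bd M k x - h (d (bd M k x)) = \<pi> (eA (\<pi> (d x)))"
        using M_bd_\<pi>[OF x] \<pi>_on_A[OF M_V(1,2)[OF m]] by simp
      also have "\<dots> = d (\<pi> x)" using xV by (simp add: \<pi>_eA_\<pi> d_\<pi>)
      also have "\<dots> = bd C k (x - h (d x))"
        using C_bd[OF C_\<pi>[OF M_V(3)[OF x]]] \<pi>_on_A[OF M_V(1,2)[OF x]] by simp
      finally show "bd M k x - h (d (bd M k x)) = bd C k (x - h (d x))" .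
    qed
    show "is_chain_map scale C M (\<lambda>k x. eA (\<pi> x))"
      unfolding is_chain_map_def
    proof (intro conjI allI ballI)
      fix k
      show "linear_between scale scale (chains C k) (chains M k) (\<lambda>x. eA (\<pi> x))"
        using in_V M_mem by (intro lin[OF linear_between_compose[OF \<pi>_linear eA_linear]]) auto
      fix x assume x: "x \<in> chains C k"
      have xV: "x \<in> V" by (rule in_V[OF x])
      have "bd M k (eA (\<pi> x)) = eA (\<pi> (d (eA (\<pi> x))))"
        using M_bd_\<pi>[OF M_mem[OF x]] by simp
      also have "\<dots> = eA (d (\<pi> (eA (\<pi> x))))" using xV by (simp add: d_\<pi>)
      also have "\<dots> = eA (\<pi> (d x))" using xV by (simp add: \<pi>_eA_\<pi> d_\<pi>)
      finally show "eA (\<pi> (bd C k x)) = bd M k (eA (\<pi> x))" using C_bd[OF x] by simp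
    qed
    fix k x
    show "eA (\<pi> (x - h (d x))) = x" if x: "x \<in> chains M k"
      using \<pi>_on_A[OF M_V(1,2)[OF x], symmetric] M_V[OF x] by (simp add: \<pi>_\<pi> eA_\<pi>)
    show "h x \<in> chains C (k + 1)" if "x \<in> chains C k" by (rule C_h[OF that])
    show "h 0 = 0" by (simp add: distrib)
    show "x - (eA (\<pi> x) - h (d (eA (\<pi> x)))) = bd C (k + 1) (h x) + h (bd C k x)"
      if x: "x \<in> chains C k"
    proof -
      have "eA (\<pi> x) - h (d (eA (\<pi> x))) = \<pi> (eA (\<pi> x))"
        using \<pi>_on_A[OF M_V(1,2)[OF M_mem[OF x]]] by simp
      also have "\<dots> = \<pi> x" by (rule \<pi>_eA_\<pi>[OF in_V[OF x]])
      finally show ?thesis using C_bd[OF C_h[OF x]] C_bd[OF x] by (simp add: \<pi>_def)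
    qed
  qed (rule M C)+
qed

end

section \<open>Incidence symbols\<close>

definition position :: "('v set \<Rightarrow> 'v rel) \<Rightarrow> 'v set \<Rightarrow> 'v \<Rightarrow> nat" where
  "position ord \<sigma> v = card {u \<in> \<sigma>. u \<noteq> v \<and> (u, v) \<in> ord \<sigma>}"

lemma omit_vertex_eq: "omit_vertex ord \<sigma> i = \<sigma> - {v \<in> \<sigma>. position ord \<sigma> v = i}"
  by (simp add: omit_vertex_def position_def)

lemma codim_one_face_iff:
  assumes "finite \<tau>" shows "codim_one_face \<sigma> \<tau> \<longleftrightarrow> (\<exists>v\<in>\<tau>. \<sigma> = \<tau> - {v})"
proof
  assume l: "codim_one_face \<sigma> \<tau>"
  then have "card (\<tau> - \<sigma>) = 1"
    using assms finite_subset[of \<sigma> \<tau>] by (simp add: codim_one_face_def card_Diff_subset)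
  then obtain v where "\<tau> - \<sigma> = {v}" by (auto simp: card_1_singleton_iff)
  then show "\<exists>v\<in>\<tau>. \<sigma> = \<tau> - {v}" using l by (auto simp: codim_one_face_def)
next
  assume "\<exists>v\<in>\<tau>. \<sigma> = \<tau> - {v}"
  then show "codim_one_face \<sigma> \<tau>"
    using assms card_Suc_Diff1[of \<tau>] by (auto simp: codim_one_face_def)
qed

context
  fixes ord :: "'v set \<Rightarrow> 'v rel" and \<sigma> :: "'v set"
  assumes lin: "linear_order_on \<sigma> (ord \<sigma>)" and fin: "finite \<sigma>"
begin

lemma position_strict_mono:
  assumes uv: "u \<in> \<sigma>" "(u, v) \<in> ord \<sigma>" "u \<noteq> v"
  shows "position ord \<sigma> u < position ord \<sigma> v"
  unfolding position_def
proof (rule psubset_card_mono)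
  have t: "trans (ord \<sigma>)" and a: "antisym (ord \<sigma>)" using lin by (auto simp: order_on_defs)
  have "{w \<in> \<sigma>. w \<noteq> u \<and> (w, u) \<in> ord \<sigma>} \<subseteq> {w \<in> \<sigma>. w \<noteq> v \<and> (w, v) \<in> ord \<sigma>}"
    using uv transD[OF t] antisymD[OF a] by blast
  then show "{w \<in> \<sigma>. w \<noteq> u \<and> (w, u) \<in> ord \<sigma>} \<subset> {w \<in> \<sigma>. w \<noteq> v \<and> (w, v) \<in> ord \<sigma>}"
    using uv by blast
qed (use fin in simp)

lemma position_bij:
  shows "bij_betw (position ord \<sigma>) \<sigma> {..<card \<sigma>}"
proof -
  have inj: "inj_on (position ord \<sigma>) \<sigma>"
  proof (rule inj_onI, rule ccontr)
    fix u v assume uv: "u \<in> \<sigma>" "v \<in> \<sigma>" "position ord \<sigma> u = position ord \<sigma> v" "u \<noteq> v"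
    then have "(u, v) \<in> ord \<sigma> \<or> (v, u) \<in> ord \<sigma>"
      using lin by (auto simp: order_on_defs total_on_def)
    then show False
      using uv position_strict_mono[of u v] position_strict_mono[of v u]
      by auto
  qed
  have "position ord \<sigma> v < card \<sigma>" if "v \<in> \<sigma>" for v
    unfolding position_def using that by (intro psubset_card_mono[OF fin]) auto
  then have "position ord \<sigma> ` \<sigma> \<subseteq> {..<card \<sigma>}" by auto
  then have "position ord \<sigma> ` \<sigma> = {..<card \<sigma>}"
    by (intro card_subset_eq) (simp_all add: card_image[OF inj])
  then show ?thesis using inj by (simp add: bij_betw_def)
qed

lemma omit_vertex_position:
  assumes v: "v \<in> \<sigma>"
  shows "omit_vertex ord \<sigma> (position ord \<sigma> v) = \<sigma> - {v}"
proof -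
  have "inj_on (position ord \<sigma>) \<sigma>" using position_bij by (simp add: bij_betw_def)
  then have "{w \<in> \<sigma>. position ord \<sigma> w = position ord \<sigma> v} = {v}"
    using v by (auto dest: inj_onD)
  then show ?thesis by (simp add: omit_vertex_eq)
qed

lemma omit_vertex_cases:
  assumes i: "i < card \<sigma>"
  obtains v where "v \<in> \<sigma>" "position ord \<sigma> v = i" "omit_vertex ord \<sigma> i = \<sigma> - {v}"
proof -
  have "i \<in> position ord \<sigma> ` \<sigma>" using position_bij i by (simp add: bij_betw_def)
  then show ?thesis using omit_vertex_position that by auto
qed

lemma incidence_remove:
  assumes v: "v \<in> \<sigma>"
  shows "incidence ord \<sigma> (\<sigma> - {v}) = (-1) ^ position ord \<sigma> v"
proof -
  have *: "(\<exists>i<card \<sigma>. P i \<and> \<sigma> - {v} = omit_vertex ord \<sigma> i) \<longleftrightarrow> P (position ord \<sigma> v)" for P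
  proof
    assume "\<exists>i<card \<sigma>. P i \<and> \<sigma> - {v} = omit_vertex ord \<sigma> i"
    then obtain i where i: "i < card \<sigma>" "P i" "\<sigma> - {v} = omit_vertex ord \<sigma> i" by blast
    obtain w where "w \<in> \<sigma>" "position ord \<sigma> w = i" "omit_vertex ord \<sigma> i = \<sigma> - {w}"
      by (rule omit_vertex_cases[OF i(1)])
    moreover from this have "w = v" using i v by blast
    ultimately show "P (position ord \<sigma> v)" using i by simp
  next
    assume "P (position ord \<sigma> v)"
    moreover have "position ord \<sigma> v < card \<sigma>"
      using position_bij v by (auto simp: bij_betw_def)
    ultimately show "\<exists>i<card \<sigma>. P i \<and> \<sigma> - {v} = omit_vertex ord \<sigma> i"
      using omit_vertex_position[OF v] by auto
  qed
  show ?thesis unfolding incidence_def *[of even] *[of odd] by simp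
qed

lemma incidence_nonzero:
  assumes nz: "incidence ord \<sigma> \<tau> \<noteq> 0"
  obtains v where "v \<in> \<sigma>" "\<tau> = \<sigma> - {v}"
proof -
  obtain i where "i < card \<sigma>" "\<tau> = omit_vertex ord \<sigma> i"
    using nz by (auto simp: incidence_def split: if_splits)
  then show ?thesis using omit_vertex_cases[of i thesis] that by blast
qed

lemma incidence_codim_one: "incidence ord \<sigma> \<tau> \<noteq> 0 \<longleftrightarrow> codim_one_face \<tau> \<sigma>"
  unfolding codim_one_face_iff[OF fin]
proof
  assume "incidence ord \<sigma> \<tau> \<noteq> 0"
  then show "\<exists>v\<in>\<sigma>. \<tau> = \<sigma> - {v}" by (rule incidence_nonzero) blast
qed (auto simp: incidence_remove)

lemma incidence_square:
  assumes "codim_one_face \<tau> \<sigma>" shows "incidence ord \<sigma> \<tau> * incidence ord \<sigma> \<tau> = 1"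
  using assms unfolding codim_one_face_iff[OF fin]
  by (auto simp: incidence_remove)

end

text \<open>Deleting the smaller vertex \<open>u\<close> lowers the position of \<open>v\<close> by one, deleting \<open>v\<close> leaves that of
  \<open>u\<close> alone: the two ways of deleting both vertices carry opposite signs.\<close>

lemma incidence_swap_ordered:
  assumes ori: "local_orientation K ord" and fin: "finite \<sigma>"
    and K: "\<sigma> \<in> K" "\<sigma> - {u} \<in> K" "\<sigma> - {v} \<in> K"
    and uv: "u \<in> \<sigma>" "v \<in> \<sigma>" "u \<noteq> v" "(u, v) \<in> ord \<sigma>"
  shows "incidence ord \<sigma> (\<sigma> - {u}) * incidence ord (\<sigma> - {u}) (\<sigma> - {u} - {v}) +
    incidence ord \<sigma> (\<sigma> - {v}) * incidence ord (\<sigma> - {v}) (\<sigma> - {v} - {u}) = 0"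
proof -
  have lin: "linear_order_on \<sigma>' (ord \<sigma>')" if "\<sigma>' \<in> K" for \<sigma>'
    using ori that unfolding local_orientation_def by blast
  have restrict: "ord (\<sigma> - {w}) = ord \<sigma> \<inter> (\<sigma> - {w}) \<times> (\<sigma> - {w})" if "\<sigma> - {w} \<in> K" for w
    using ori K(1) that unfolding local_orientation_def by blast
  have "(v, u) \<notin> ord \<sigma>" using lin[OF K(1)] uv by (auto simp: order_on_defs dest: antisymD)
  then have "{w \<in> \<sigma> - {v}. w \<noteq> u \<and> (w, u) \<in> ord (\<sigma> - {v})} = {w \<in> \<sigma>. w \<noteq> u \<and> (w, u) \<in> ord \<sigma>}"
    using uv by (auto simp: restrict[OF K(3)])
  then have pu: "position ord (\<sigma> - {v}) u = position ord \<sigma> u" by (simp add: position_def)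
  have "{w \<in> \<sigma>. w \<noteq> v \<and> (w, v) \<in> ord \<sigma>} =
      insert u {w \<in> \<sigma> - {u}. w \<noteq> v \<and> (w, v) \<in> ord (\<sigma> - {u})}"
    using uv by (auto simp: restrict[OF K(2)])
  then have pv: "position ord \<sigma> v = Suc (position ord (\<sigma> - {u}) v)"
    using fin by (simp add: position_def)
  show ?thesis
    using incidence_remove[where ord = ord, OF lin[OF K(1)] fin] uv pu pv
      incidence_remove[where ord = ord, OF lin[OF K(2)], of v]
      incidence_remove[where ord = ord, OF lin[OF K(3)], of u] fin
    by simp
qed

text \<open>If some intermediate \<open>\<tau>\<close> contributes, then \<open>\<rho>\<close> arises from \<open>\<sigma>\<close> by deleting two vertices, and the
  only intermediate simplices are the two obtained by deleting one of them.\<close>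

proposition incidence_sum_zero:
  assumes cx: "finite_simplicial_complex K" and ori: "local_orientation K ord"
    and K: "\<sigma> \<in> K" "\<rho> \<in> K"
  shows "(\<Sum>\<tau>\<in>K. incidence ord \<sigma> \<tau> * incidence ord \<tau> \<rho>) = 0"
proof (cases "\<exists>\<tau>\<in>K. incidence ord \<sigma> \<tau> * incidence ord \<tau> \<rho> \<noteq> 0")
  case False
  then show ?thesis by (intro sum.neutral) blast
next
  case True
  have fin: "finite \<sigma>'" if "\<sigma>' \<in> K" for \<sigma>'
    using cx that unfolding finite_simplicial_complex_def by blast
  have lin: "linear_order_on \<sigma>' (ord \<sigma>')" if "\<sigma>' \<in> K" for \<sigma>'
    using ori that unfolding local_orientation_def by blast
  obtain \<tau> where \<tau>: "\<tau> \<in> K" "incidence ord \<sigma> \<tau> \<noteq> 0" "incidence ord \<tau> \<rho> \<noteq> 0"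
    using True mult_eq_0_iff by blast
  obtain u where u: "u \<in> \<sigma>" "\<tau> = \<sigma> - {u}"
    by (rule incidence_nonzero[where ord = ord, OF lin[OF K(1)] fin[OF K(1)] \<tau>(2)])
  obtain v where v: "v \<in> \<tau>" "\<rho> = \<tau> - {v}"
    by (rule incidence_nonzero[where ord = ord, OF lin[OF \<tau>(1)] fin[OF \<tau>(1)] \<tau>(3)])
  have uv: "v \<in> \<sigma>" "u \<noteq> v" "\<rho> = \<sigma> - {u} - {v}" "\<rho> = \<sigma> - {v} - {u}" using u v by auto
  have "\<rho> \<noteq> {}" "\<And>\<tau>. \<tau> \<subseteq> \<sigma> \<Longrightarrow> \<tau> \<noteq> {} \<Longrightarrow> \<tau> \<in> K"
    using cx K unfolding finite_simplicial_complex_def by blast+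
  then have vK: "\<sigma> - {v} \<in> K" using uv by blast
  have other: "incidence ord \<sigma> \<tau>' * incidence ord \<tau>' \<rho> = 0"
    if "\<tau>' \<in> K - {\<sigma> - {u}, \<sigma> - {v}}" for \<tau>'
  proof (rule ccontr)
    assume "incidence ord \<sigma> \<tau>' * incidence ord \<tau>' \<rho> \<noteq> 0"
    then have nz: "incidence ord \<sigma> \<tau>' \<noteq> 0" "incidence ord \<tau>' \<rho> \<noteq> 0" by auto
    have "\<tau>' \<in> K" using that by blast
    obtain w where w: "w \<in> \<sigma>" "\<tau>' = \<sigma> - {w}"
      by (rule incidence_nonzero[where ord = ord, OF lin[OF K(1)] fin[OF K(1)] nz(1)])
    obtain w' where "\<rho> = \<tau>' - {w'}"
      by (rule incidence_nonzero[where ord = ord, OF lin[OF \<open>\<tau>' \<in> K\<close>] fin[OF \<open>\<tau>' \<in> K\<close>] nz(2)])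
    then have "w \<notin> \<rho>" using w by blast
    then have "w = u \<or> w = v" using w(1) uv(3) by blast
    then show False using that w(2) by blast
  qed
  have uK: "\<sigma> - {u} \<in> K" using \<tau> u by simp
  have finK: "finite K" using cx by (simp add: finite_simplicial_complex_def)
  have ne: "\<sigma> - {u} \<noteq> \<sigma> - {v}" using u uv by blast
  have "(\<Sum>\<tau>\<in>K. incidence ord \<sigma> \<tau> * incidence ord \<tau> \<rho>) =
      (\<Sum>\<tau>\<in>{\<sigma> - {u}, \<sigma> - {v}}. incidence ord \<sigma> \<tau> * incidence ord \<tau> \<rho>)"
    using finK uK vK other by (intro sum.mono_neutral_right) auto
  also have "\<dots> = incidence ord \<sigma> (\<sigma> - {u}) * incidence ord (\<sigma> - {u}) (\<sigma> - {u} - {v}) +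
      incidence ord \<sigma> (\<sigma> - {v}) * incidence ord (\<sigma> - {v}) (\<sigma> - {v} - {u})"
    using ne uv(3,4) by simp
  also have "\<dots> = 0"
  proof (cases "(u, v) \<in> ord \<sigma>")
    case True
    then show ?thesis by (intro incidence_swap_ordered[OF ori fin[OF K(1)] K(1) uK vK u(1) uv(1,2)])
  next
    case False
    then have "(v, u) \<in> ord \<sigma>"
      using lin[OF K(1)] u(1) uv(1,2) by (auto simp: order_on_defs total_on_def)
    then show ?thesis
      using incidence_swap_ordered[OF ori fin[OF K(1)] K(1) vK uK uv(1) u(1)] uv(2)
      by (simp add: add.commute)
  qed
  finally show ?thesis .
qed

section \<open>Paths of an acyclic matching\<close>

lemma successively_nth:
  "successively P xs \<longleftrightarrow> (\<forall>i. Suc i < length xs \<longrightarrow> P (xs ! i) (xs ! Suc i))"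
proof (induction P xs rule: successively.induct)
  case (3 P x y xs)
  have "(\<forall>i. Suc i < length (x # y # xs) \<longrightarrow> P ((x # y # xs) ! i) ((x # y # xs) ! Suc i)) \<longleftrightarrow>
      P x y \<and> (\<forall>i. Suc i < length (y # xs) \<longrightarrow> P ((y # xs) ! i) ((y # xs) ! Suc i))"
    by (auto simp: less_Suc_eq_0_disj)
  then show ?case using 3 by simp
qed auto

text \<open>The map \<open>g\<close> pairs \<open>Q\<close> with \<open>E - {a}\<close>, and the summands of each such pair cancel.\<close>

lemma sum_sign_reversing:
  fixes F :: "'a \<Rightarrow> 'b::ab_group_add"
  assumes P: "finite P" and E: "E = insert a (g ` Q)" "E \<subseteq> P" and a: "a \<notin> g ` Q"
    and Q: "Q \<subseteq> P - E" and inj: "inj_on g Q"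
    and step: "\<And>q. q \<in> Q \<Longrightarrow> F (g q) = - F q"
    and vanish: "\<And>q. q \<in> P - E - Q \<Longrightarrow> F q = 0"
  shows "sum F P = F a"
proof -
  have "finite Q" using P Q by (meson Diff_subset finite_subset)
  then have "sum F E = F a + (\<Sum>q\<in>Q. F (g q))"
    unfolding E(1) using a inj by (simp add: sum.reindex)
  also have "(\<Sum>q\<in>Q. F (g q)) = - sum F Q" by (simp add: step sum_negf)
  also have "sum F Q = sum F (P - E)"
    using P Q vanish by (intro sum.mono_neutral_left) auto
  finally show ?thesis using sum.subset_diff[OF E(2) P, of F] by simp
qed

context
  fixes K :: "'v set set" and M :: "('v set \<times> 'v set) set"
  assumes acyclic: "acyclic_partial_matching K M"
begin

lemma matching_pair:
  assumes "p \<in> M" shows "fst p \<in> K" "snd p \<in> K" "codim_one_face (fst p) (snd p)"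
  using acyclic assms by (auto simp: acyclic_partial_matching_def partial_matching_def)

lemma matching_unique:
  assumes "p \<in> M" "q \<in> M" "fst p = fst q \<or> snd p = snd q \<or> fst p = snd q" shows "p = q"
proof -
  have "{fst p, snd p} \<inter> {fst q, snd q} \<noteq> {} \<longrightarrow> p = q"
    using acyclic assms(1,2) unfolding acyclic_partial_matching_def partial_matching_def by blast
  then show ?thesis using assms(3) by auto
qed

lemma matching_disjoint:
  assumes "p \<in> M" "q \<in> M" shows "fst p \<noteq> snd q"
proof
  assume "fst p = snd q"
  then have "codim_one_face (fst p) (fst p)"
    using matching_unique[OF assms] matching_pair[OF assms(1)] by simp
  then show False by (simp add: codim_one_face_def)
qed

text \<open>In a matching, simplices repeat along a path only if pairs do, so distinctness of the pairs is
  enough.\<close>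

lemma is_path_iff:
  "is_path M \<rho> \<longleftrightarrow> \<rho> \<noteq> [] \<and> set \<rho> \<subseteq> M \<and> distinct \<rho> \<and>
     successively (\<lambda>p q. codim_one_face (fst q) (snd p)) \<rho>"
proof -
  have "distinct (map fst \<rho> @ map snd \<rho>) \<longleftrightarrow> distinct \<rho>" if \<rho>: "set \<rho> \<subseteq> M"
  proof -
    have "inj_on fst (set \<rho>)" "inj_on snd (set \<rho>)"
      by (rule inj_onI; rule matching_unique; use \<rho> in blast)+
    moreover have "fst ` set \<rho> \<inter> snd ` set \<rho> = {}"
      using matching_disjoint \<rho> by fastforce
    ultimately show ?thesis by (auto simp: distinct_map)
  qed
  then show ?thesis by (auto simp: is_path_def successively_nth)
qed

lemma is_path_singleton: "is_path M [p] \<longleftrightarrow> p \<in> M"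
  by (auto simp: is_path_iff)

lemma path_gradient:
  assumes "is_path M \<rho>" "codim_one_face (fst (hd \<rho>)) (snd (last \<rho>))"
  shows "length \<rho> = 1"
  using assms acyclic
  by (auto simp: acyclic_partial_matching_def is_gradient_def codim_one_face_def)

text \<open>Prolonging a path cannot revisit one of its pairs, since the stretch between the two visits
  would be a path whose first simplex is a face of its last one; so acyclicity makes
  extendability a condition on the adjacent pair alone.\<close>

lemma is_path_Cons:
  assumes "\<rho> \<noteq> []"
  shows "is_path M (p # \<rho>) \<longleftrightarrow>
    p \<in> M \<and> is_path M \<rho> \<and> codim_one_face (fst (hd \<rho>)) (snd p) \<and> hd \<rho> \<noteq> p"
proof
  assume l: "is_path M (p # \<rho>)"
  have "hd \<rho> \<in> set \<rho>" using assms by simp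
  then show "p \<in> M \<and> is_path M \<rho> \<and> codim_one_face (fst (hd \<rho>)) (snd p) \<and> hd \<rho> \<noteq> p"
    using l assms by (auto simp: is_path_iff successively_Cons)
next
  assume r: "p \<in> M \<and> is_path M \<rho> \<and> codim_one_face (fst (hd \<rho>)) (snd p) \<and> hd \<rho> \<noteq> p"
  have "p \<notin> set \<rho>"
  proof
    assume "p \<in> set \<rho>"
    then obtain qs rs where \<rho>: "\<rho> = qs @ p # rs" by (meson split_list)
    have "is_path M (qs @ [p])"
      using r unfolding \<rho> is_path_iff by (auto simp: successively_append_iff)
    moreover have "hd (qs @ [p]) = hd \<rho>" using \<rho> by (cases qs) auto
    ultimately have "length (qs @ [p]) = 1" using r by (intro path_gradient) auto
    then show False using r \<rho> by simp
  qed
  then show "is_path M (p # \<rho>)"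
    using r assms by (auto simp: is_path_iff successively_Cons)
qed

lemma is_path_snoc:
  assumes "\<rho> \<noteq> []"
  shows "is_path M (\<rho> @ [p]) \<longleftrightarrow>
    p \<in> M \<and> is_path M \<rho> \<and> codim_one_face (fst p) (snd (last \<rho>)) \<and> last \<rho> \<noteq> p"
proof
  assume l: "is_path M (\<rho> @ [p])"
  have "last \<rho> \<in> set \<rho>" using assms by simp
  then show "p \<in> M \<and> is_path M \<rho> \<and> codim_one_face (fst p) (snd (last \<rho>)) \<and> last \<rho> \<noteq> p"
    using l assms by (auto simp: is_path_iff successively_append_iff)
next
  assume r: "p \<in> M \<and> is_path M \<rho> \<and> codim_one_face (fst p) (snd (last \<rho>)) \<and> last \<rho> \<noteq> p"
  have "p \<notin> set \<rho>"
  proof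
    assume "p \<in> set \<rho>"
    then obtain qs rs where \<rho>: "\<rho> = qs @ p # rs" by (meson split_list)
    have "is_path M (p # rs)"
      using r unfolding \<rho> is_path_iff by (auto simp: successively_append_iff)
    moreover have "last (p # rs) = last \<rho>" using \<rho> by simp
    ultimately have "length (p # rs) = 1" using r by (intro path_gradient) auto
    then show False using r \<rho> by simp
  qed
  then show "is_path M (\<rho> @ [p])"
    using r assms by (auto simp: is_path_iff successively_append_iff)
qed

lemma path_ends:
  assumes "is_path M \<rho>" shows "\<rho> \<noteq> []" "hd \<rho> \<in> M" "last \<rho> \<in> M"
  using assms by (auto simp: is_path_iff)

lemma path_card: "is_path M \<rho> \<Longrightarrow> card (snd (last \<rho>)) = card (fst (hd \<rho>)) + 1"
proof (induction \<rho>)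
  case (Cons p \<rho>)
  show ?case
  proof (cases "\<rho> = []")
    case True
    then show ?thesis
      using Cons.prems matching_pair(3) by (auto simp: is_path_singleton codim_one_face_def)
  next
    case False
    then show ?thesis
      using Cons matching_pair(3)[of p] by (auto simp: is_path_Cons codim_one_face_def)
  qed
qed (simp add: is_path_def)

lemma finite_paths: "finite K \<Longrightarrow> finite {\<rho>. is_path M \<rho>}"
proof -
  assume "finite K"
  moreover have "M \<subseteq> K \<times> K" using matching_pair by (auto simp: mem_Times_iff)
  ultimately have "finite M" by (meson finite_SigmaI finite_subset)
  then have "finite {\<rho>. distinct \<rho> \<and> set \<rho> \<subseteq> M}"
    using finite_subset_distinct by (simp add: conj_commute)
  then show ?thesis by (rule rev_finite_subset) (auto simp: is_path_iff)
qed

text \<open>The paths ending in \<open>p\<close> are \<open>[p]\<close> and the prolongations of paths not ending in \<open>p\<close>. If a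
  summand changes sign under prolongation, everything cancels except the trivial path.\<close>

lemma sum_paths_snoc:
  fixes F :: "('v set \<times> 'v set) list \<Rightarrow> 'b::ab_group_add"
  assumes fin: "finite K" and p: "p \<in> M"
    and step: "\<And>\<rho>. is_path M \<rho> \<Longrightarrow> is_path M (\<rho> @ [p]) \<Longrightarrow> F (\<rho> @ [p]) = - F \<rho>"
    and vanish: "\<And>\<rho>. is_path M \<rho> \<Longrightarrow> \<not> codim_one_face (fst p) (snd (last \<rho>)) \<Longrightarrow> F \<rho> = 0"
  shows "(\<Sum>\<rho>\<in>{\<rho>. is_path M \<rho>}. F \<rho>) = F [p]"
proof (rule sum_sign_reversing)
  let ?P = "{\<rho>. is_path M \<rho>}"
  let ?Q = "{\<rho>. is_path M \<rho> \<and> is_path M (\<rho> @ [p])}"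
  show "{\<rho> \<in> ?P. last \<rho> = p} = insert [p] ((\<lambda>\<rho>. \<rho> @ [p]) ` ?Q)"
  proof -
    have "\<rho> \<in> insert [p] ((\<lambda>\<rho>. \<rho> @ [p]) ` ?Q)" if "is_path M \<rho>" "last \<rho> = p" for \<rho>
    proof -
      have \<rho>: "\<rho> = butlast \<rho> @ [p]"
        using that path_ends(1) append_butlast_last_id by metis
      show ?thesis
      proof (cases "butlast \<rho> = []")
        case True
        then show ?thesis using \<rho> by simp
      next
        case False
        then have "butlast \<rho> \<in> ?Q" using that(1) \<rho> is_path_snoc[of "butlast \<rho>" p] by auto
        then show ?thesis using \<rho> by blast
      qed
    qed
    then show ?thesis using p by (auto simp: is_path_singleton)
  qed
  show "?Q \<subseteq> ?P - {\<rho> \<in> ?P. last \<rho> = p}" using is_path_snoc path_ends(1) by blast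
  show "F \<rho> = 0" if "\<rho> \<in> ?P - {\<rho> \<in> ?P. last \<rho> = p} - ?Q" for \<rho>
    using that is_path_snoc path_ends(1) vanish p by blast
qed (use step finite_paths[OF fin] in \<open>auto dest: path_ends(1) simp: inj_on_def\<close>)

text \<open>The mirror image, for the first pair of a path.\<close>

lemma sum_paths_Cons:
  fixes F :: "('v set \<times> 'v set) list \<Rightarrow> 'b::ab_group_add"
  assumes fin: "finite K" and p: "p \<in> M"
    and step: "\<And>\<rho>. is_path M \<rho> \<Longrightarrow> is_path M (p # \<rho>) \<Longrightarrow> F (p # \<rho>) = - F \<rho>"
    and vanish: "\<And>\<rho>. is_path M \<rho> \<Longrightarrow> \<not> codim_one_face (fst (hd \<rho>)) (snd p) \<Longrightarrow> F \<rho> = 0"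
  shows "(\<Sum>\<rho>\<in>{\<rho>. is_path M \<rho>}. F \<rho>) = F [p]"
proof (rule sum_sign_reversing)
  let ?P = "{\<rho>. is_path M \<rho>}"
  let ?Q = "{\<rho>. is_path M \<rho> \<and> is_path M (p # \<rho>)}"
  show "{\<rho> \<in> ?P. hd \<rho> = p} = insert [p] ((#) p ` ?Q)"
  proof -
    have "\<rho> \<in> insert [p] ((#) p ` ?Q)" if "is_path M \<rho>" "hd \<rho> = p" for \<rho>
    proof -
      have \<rho>: "\<rho> = p # tl \<rho>" using that path_ends(1) hd_Cons_tl by metis
      show ?thesis
      proof (cases "tl \<rho> = []")
        case True
        then show ?thesis using \<rho> by simp
      next
        case False
        then have "tl \<rho> \<in> ?Q" using that(1) \<rho> is_path_Cons[of "tl \<rho>" p] by auto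
        then show ?thesis using \<rho> by blast
      qed
    qed
    then show ?thesis using p by (auto simp: is_path_singleton)
  qed
  show "?Q \<subseteq> ?P - {\<rho> \<in> ?P. hd \<rho> = p}" using is_path_Cons path_ends(1) by blast
  show "F \<rho> = 0" if "\<rho> \<in> ?P - {\<rho> \<in> ?P. hd \<rho> = p} - ?Q" for \<rho>
    using that is_path_Cons path_ends(1) vanish p by blast
qed (use step finite_paths[OF fin] in \<open>auto dest: path_ends(1) simp: inj_on_def\<close>)

end

lemma path_sign_Cons:
  assumes "\<rho> \<noteq> []"
  shows "path_sign ord (p # \<rho>) =
    - incidence ord (snd p) (fst p) * incidence ord (snd p) (fst (hd \<rho>)) * path_sign ord \<rho>"
proof -
  obtain n where n: "length \<rho> = Suc n" using assms by (cases \<rho>) auto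
  show ?thesis
    using assms by (simp add: path_sign_def n prod.lessThan_Suc_shift hd_conv_nth del: prod.lessThan_Suc)
qed

lemma path_sign_snoc:
  assumes "\<rho> \<noteq> []"
  shows "path_sign ord (\<rho> @ [p]) =
    - incidence ord (snd p) (fst p) * incidence ord (snd (last \<rho>)) (fst p) * path_sign ord \<rho>"
proof -
  obtain n where n: "length \<rho> = Suc n" using assms by (cases \<rho>) auto
  have "(\<Prod>i<n. incidence ord (snd ((\<rho> @ [p]) ! i)) (fst ((\<rho> @ [p]) ! Suc i))) =
      (\<Prod>i<n. incidence ord (snd (\<rho> ! i)) (fst (\<rho> ! Suc i)))"
    using n by (intro prod.cong) (auto simp: nth_append)
  moreover have "(\<Prod>i<Suc n. incidence ord (snd ((\<rho> @ [p]) ! i)) (fst ((\<rho> @ [p]) ! i))) =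
      (\<Prod>i<Suc n. incidence ord (snd (\<rho> ! i)) (fst (\<rho> ! i)))"
    using n by (intro prod.cong) (auto simp: nth_append)
  moreover have "(\<rho> @ [p]) ! n = last \<rho>" "(\<rho> @ [p]) ! Suc n = p"
    using n assms by (auto simp: nth_append last_conv_nth)
  ultimately show ?thesis
    using n by (simp add: path_sign_def mult_ac)
qed

lemma path_map_Cons:
  "\<rho> \<noteq> [] \<Longrightarrow> path_map St ext (p # \<rho>) y =
    path_map St ext \<rho> (ext (snd p) (fst (hd \<rho>)) (inv_into (St (snd p)) (ext (snd p) (fst p)) y))"
  by (cases p; cases \<rho>) auto

lemma path_map_snoc:
  "\<rho> \<noteq> [] \<Longrightarrow> path_map St ext (\<rho> @ [p]) y =
    inv_into (St (snd p)) (ext (snd p) (fst p))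
      (ext (snd (last \<rho>)) (fst p) (path_map St ext \<rho> y))"
proof (induction \<rho> arbitrary: y)
  case (Cons q \<rho>)
  then show ?case by (cases "\<rho> = []"; cases p; cases q) (auto simp: path_map_Cons)
qed simp

section \<open>The path operator of a compatible matching\<close>

locale matched_cosheaf = cosheaf scale K St ext
  for scale :: "'k::field \<Rightarrow> 'a::ab_group_add \<Rightarrow> 'a" and K :: "'v set set" and St ext +
  fixes ord :: "'v set \<Rightarrow> 'v rel" and M :: "('v set \<times> 'v set) set"
  assumes complex: "finite_simplicial_complex K"
    and orientation: "local_orientation K ord"
    and acyclic: "acyclic_partial_matching K M"
    and compatible: "compatible_matching St ext M"
begin

abbreviation block where "block \<equiv> cosheaf_block scale ord ext"
abbreviation weight where "weight \<equiv> path_weight scale ord St ext"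

text \<open>For a matched pair this is the inverse of the block of the boundary: the sign is its own
  inverse.\<close>

definition matched_inverse :: "'v set \<times> 'v set \<Rightarrow> 'a \<Rightarrow> 'a" where
  "matched_inverse p y =
     scale (of_int (incidence ord (snd p) (fst p))) (inv_into (St (snd p)) (ext (snd p) (fst p)) y)"

lemma finite_K: "finite K"
  using complex by (simp add: finite_simplicial_complex_def)

lemma finite_simplex: "\<sigma> \<in> K \<Longrightarrow> finite \<sigma>"
  using complex unfolding finite_simplicial_complex_def by blast

lemma ord_linear: "\<sigma> \<in> K \<Longrightarrow> linear_order_on \<sigma> (ord \<sigma>)"
  using orientation unfolding local_orientation_def by blast

lemmas incidence_codim = incidence_codim_one[where ord = ord, OF ord_linear finite_simplex]
lemmas pair = matching_pair[OF acyclic]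

lemma block_zero: "\<sigma> \<in> K \<Longrightarrow> \<not> codim_one_face \<tau> \<sigma> \<Longrightarrow> block \<sigma> \<tau> x = 0"
  using incidence_codim[of \<sigma> \<tau>] by (simp add: cosheaf_block_def)

lemma zero_linear: "subspace W \<Longrightarrow> linear_between scale scale V W (\<lambda>x. 0)"
  by (simp add: linear_between_def subspace_0)

lemma block_linear:
  assumes "\<sigma> \<in> K" "\<tau> \<in> K" shows "linear_between scale scale (St \<sigma>) (St \<tau>) (block \<sigma> \<tau>)"
proof (cases "codim_one_face \<tau> \<sigma>")
  case True
  then have "linear_between scale scale (St \<sigma>) (St \<tau>) (ext \<sigma> \<tau>)"
    using assms by (intro ext_linear) (auto simp: codim_one_face_def)
  then show ?thesis
    unfolding cosheaf_block_def[abs_def] using stalk_subspace[OF assms(2)]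
    by (rule linear_between_cmul)
next
  case False
  then have "block \<sigma> \<tau> = (\<lambda>x. 0)" using block_zero[OF assms(1)] by blast
  then show ?thesis using zero_linear[OF stalk_subspace[OF assms(2)]] by simp
qed

lemma inv_ext_linear:
  assumes "p \<in> M"
  shows "linear_between scale scale (St (fst p)) (St (snd p))
    (inv_into (St (snd p)) (ext (snd p) (fst p)))"
  using assms pair[OF assms] compatible
  by (intro linear_between_inv_into ext_linear stalk_subspace)
    (auto simp: compatible_matching_def codim_one_face_def)

lemma matched_inverse_linear:
  assumes "p \<in> M"
  shows "linear_between scale scale (St (fst p)) (St (snd p)) (matched_inverse p)"
  unfolding matched_inverse_def[abs_def]
  by (intro linear_between_cmul inv_ext_linear assms stalk_subspace pair)

lemma matched_inverse_block:
  assumes p: "p \<in> M" and x: "x \<in> St (snd p)"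
  shows "matched_inverse p (block (snd p) (fst p) x) = x"
proof -
  let ?a = "incidence ord (snd p) (fst p)"
  have "bij_betw (ext (snd p) (fst p)) (St (snd p)) (St (fst p))"
    using compatible p by (auto simp: compatible_matching_def)
  then have "inv_into (St (snd p)) (ext (snd p) (fst p)) (ext (snd p) (fst p) x) = x"
    and "ext (snd p) (fst p) x \<in> St (fst p)"
    using x by (auto simp: bij_betw_def)
  then have "matched_inverse p (block (snd p) (fst p) x) = scale (of_int (?a * ?a)) x"
    by (simp add: matched_inverse_def cosheaf_block_def linear_between_scale[OF inv_ext_linear[OF p]])
  then show ?thesis
    using incidence_square[where ord = ord, OF ord_linear finite_simplex] pair[OF p] by simp
qed

lemma block_matched_inverse:
  assumes p: "p \<in> M" and y: "y \<in> St (fst p)"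
  shows "block (snd p) (fst p) (matched_inverse p y) = y"
proof -
  let ?a = "incidence ord (snd p) (fst p)" and ?f = "ext (snd p) (fst p)"
  have b: "bij_betw ?f (St (snd p)) (St (fst p))"
    using compatible p by (auto simp: compatible_matching_def)
  have l: "linear_between scale scale (St (snd p)) (St (fst p)) ?f"
    using pair[OF p] by (intro ext_linear) (auto simp: codim_one_face_def)
  have "?f (inv_into (St (snd p)) ?f y) = y" and "inv_into (St (snd p)) ?f y \<in> St (snd p)"
    using b y by (auto simp: bij_betw_def f_inv_into_f inv_into_into)
  then have "block (snd p) (fst p) (matched_inverse p y) = scale (of_int (?a * ?a)) y"
    by (simp add: matched_inverse_def cosheaf_block_def linear_between_scale[OF l])
  then show ?thesis
    using incidence_square[where ord = ord, OF ord_linear finite_simplex] pair[OF p] by simp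
qed

lemma path_map_linear:
  "is_path M \<rho> \<Longrightarrow> linear_between scale scale (St (fst (hd \<rho>))) (St (snd (last \<rho>)))
    (path_map St ext \<rho>)"
proof (induction \<rho>)
  case (Cons p \<rho>)
  show ?case
  proof (cases "\<rho> = []")
    case True
    then have "p \<in> M" using Cons.prems by (simp add: is_path_singleton[OF acyclic])
    moreover have "path_map St ext [p] = inv_into (St (snd p)) (ext (snd p) (fst p))"
      by (cases p) simp
    ultimately show ?thesis using inv_ext_linear True by simp
  next
    case False
    then have p: "p \<in> M" "is_path M \<rho>" "codim_one_face (fst (hd \<rho>)) (snd p)"
      using Cons.prems by (auto simp: is_path_Cons[OF acyclic])
    have "linear_between scale scale (St (snd p)) (St (fst (hd \<rho>))) (ext (snd p) (fst (hd \<rho>)))"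
      using p(3) pair[OF p(1)] pair[OF path_ends(2)[OF acyclic p(2)]]
      by (intro ext_linear) (auto simp: codim_one_face_def)
    then have "linear_between scale scale (St (fst p)) (St (snd (last \<rho>)))
        (\<lambda>y. path_map St ext \<rho> (ext (snd p) (fst (hd \<rho>))
          (inv_into (St (snd p)) (ext (snd p) (fst p)) y)))"
      using Cons.IH[OF p(2)] inv_ext_linear[OF p(1)] by (metis (no_types) linear_between_compose)
    then show ?thesis using False by (simp add: path_map_Cons[OF False, abs_def])
  qed
qed (simp add: is_path_def)

lemma weight_linear:
  assumes "is_path M \<rho>"
  shows "linear_between scale scale (St (fst (hd \<rho>))) (St (snd (last \<rho>))) (weight \<rho>)"
  unfolding path_weight_def[abs_def]
  by (intro linear_between_cmul path_map_linear assms stalk_subspace pair path_ends(3)[OF acyclic])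

lemma weight_singleton: "weight [p] y = - matched_inverse p y"
  by (cases p) (simp add: path_weight_def matched_inverse_def path_sign_def)

text \<open>The sign \<open>\<epsilon>\<^sub>\<rho>\<close> consists of one incidence symbol for each map along the path and one factor \<open>-1\<close>
  for each pair. Up to the latter, the weight is therefore an alternating composite of boundary
  blocks and inverses of boundary blocks.\<close>

lemma weight_Cons:
  assumes \<rho>: "\<rho> \<noteq> []" and path: "is_path M (p # \<rho>)" and y: "y \<in> St (fst p)"
  shows "weight (p # \<rho>) y = - weight \<rho> (block (snd p) (fst (hd \<rho>)) (matched_inverse p y))"
proof -
  have p: "p \<in> M" "is_path M \<rho>" "codim_one_face (fst (hd \<rho>)) (snd p)"
    using path by (auto simp: is_path_Cons[OF acyclic \<rho>])
  have l: "linear_between scale scale (St (snd p)) (St (fst (hd \<rho>))) (ext (snd p) (fst (hd \<rho>)))"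
    using p(3) pair[OF p(1)] pair[OF path_ends(2)[OF acyclic p(2)]]
    by (intro ext_linear) (auto simp: codim_one_face_def)
  note mem = linear_between_mem[OF inv_ext_linear[OF p(1)] y]
  note pull_ext = linear_between_scale[OF l mem]
  note pull_path = linear_between_scale[OF path_map_linear[OF p(2)] linear_between_mem[OF l mem]]
  show ?thesis
    unfolding path_weight_def matched_inverse_def cosheaf_block_def path_map_Cons[OF \<rho>]
      path_sign_Cons[OF \<rho>] pull_ext scale_scale pull_path
    by (simp add: mult_ac)
qed

lemma weight_snoc:
  assumes \<rho>: "\<rho> \<noteq> []" and path: "is_path M (\<rho> @ [p])" and y: "y \<in> St (fst (hd \<rho>))"
  shows "weight (\<rho> @ [p]) y = - matched_inverse p (block (snd (last \<rho>)) (fst p) (weight \<rho> y))"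
proof -
  have p: "p \<in> M" "is_path M \<rho>" "codim_one_face (fst p) (snd (last \<rho>))"
    using path by (auto simp: is_path_snoc[OF acyclic \<rho>])
  have l: "linear_between scale scale (St (snd (last \<rho>))) (St (fst p)) (ext (snd (last \<rho>)) (fst p))"
    using p(3) pair[OF p(1)] pair[OF path_ends(3)[OF acyclic p(2)]]
    by (intro ext_linear) (auto simp: codim_one_face_def)
  note mem = linear_between_mem[OF path_map_linear[OF p(2)] y]
  note pull_ext = linear_between_scale[OF l mem]
  note pull_inv = linear_between_scale[OF inv_ext_linear[OF p(1)] linear_between_mem[OF l mem]]
  show ?thesis
    unfolding path_weight_def matched_inverse_def cosheaf_block_def path_map_snoc[OF \<rho>]
      path_sign_snoc[OF \<rho>] pull_ext scale_scale pull_inv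
    by (simp add: mult_ac)
qed

section \<open>The total complex of the cosheaf\<close>

abbreviation total :: "('v set \<Rightarrow> 'a) set" where "total \<equiv> direct_sum K St"

abbreviation boundary :: "('v set \<Rightarrow> 'a) \<Rightarrow> 'v set \<Rightarrow> 'a" where
  "boundary \<equiv> block_map K K block"

text \<open>If \<open>m\<close> is the part of the block from the upper to the lower matched simplices given by the
  matched pairs, and \<open>r\<close> the rest of that block, the sum over paths is the Neumann series
  \<open>\<Sum>\<^sub>n (- m\<^sup>-\<^sup>1 r)\<^sup>n m\<^sup>-\<^sup>1\<close> for the inverse of \<open>m + r\<close>. The weight of a path carries the opposite sign
  of its term in this series, whence the minus sign in front.\<close>

definition path_operator :: "('v set \<Rightarrow> 'a) \<Rightarrow> 'v set \<Rightarrow> 'a" where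
  "path_operator x \<tau> =
     - (\<Sum>\<rho>\<in>{\<rho>. is_path M \<rho>}. if snd (last \<rho>) = \<tau> then weight \<rho> (x (fst (hd \<rho>))) else 0)"

definition restrict_to :: "'v set set \<Rightarrow> ('v set \<Rightarrow> 'a) \<Rightarrow> 'v set \<Rightarrow> 'a" where
  "restrict_to I x = (\<lambda>\<sigma>. if \<sigma> \<in> I then x \<sigma> else 0)"

lemma vector_space_fun_scale: "vector_space (fun_scale scale)"
  by unfold_locales
    (auto simp: fun_scale_def fun_eq_iff scale_right_distrib scale_left_distrib)

interpretation fs: vector_space "fun_scale scale"
  by (rule vector_space_fun_scale)

lemma direct_sum_subspace: "I \<subseteq> K \<Longrightarrow> fs.subspace (direct_sum I St)"
  by (rule fs.subspaceI)
    (auto simp: direct_sum_def fun_scale_def subset_iff intro: subspace_0[OF stalk_subspace]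
      subspace_add[OF stalk_subspace] subspace_scale[OF stalk_subspace])

lemma total_mem: "x \<in> total \<Longrightarrow> \<sigma> \<in> K \<Longrightarrow> x \<sigma> \<in> St \<sigma>"
  and total_outside: "x \<in> total \<Longrightarrow> \<sigma> \<notin> K \<Longrightarrow> x \<sigma> = 0"
  by (auto simp: direct_sum_def)

lemmas block_mem = linear_between_mem[OF block_linear]

lemma start_mem: "is_path M \<rho> \<Longrightarrow> x \<in> total \<Longrightarrow> x (fst (hd \<rho>)) \<in> St (fst (hd \<rho>))"
  by (rule total_mem[OF _ pair(1)[OF path_ends(2)[OF acyclic]]])

lemma weight_mem: "is_path M \<rho> \<Longrightarrow> x \<in> total \<Longrightarrow> weight \<rho> (x (fst (hd \<rho>))) \<in> St (snd (last \<rho>))"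
  by (rule linear_between_mem[OF weight_linear start_mem])

lemma path_start_in_K: "is_path M \<rho> \<Longrightarrow> fst (hd \<rho>) \<in> K"
  and path_end_in_K: "is_path M \<rho> \<Longrightarrow> snd (last \<rho>) \<in> K"
  by (auto intro: pair(1)[OF path_ends(2)[OF acyclic]] pair(2)[OF path_ends(3)[OF acyclic]])

lemma boundary_linear: "linear_between (fun_scale scale) (fun_scale scale) total total boundary"
proof -
  have "boundary x \<in> total" if "x \<in> total" for x
    using that
    by (auto simp: direct_sum_def block_map_def intro!: subspace_sum stalk_subspace block_mem)
  moreover have "boundary (x + y) = boundary x + boundary y" if "x \<in> total" "y \<in> total" for x y
    using that linear_between_add[OF block_linear]
    by (auto simp: block_map_def fun_eq_iff sum.distrib[symmetric] total_mem intro!: sum.cong)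
  moreover have "boundary (fun_scale scale c x) = fun_scale scale c (boundary x)"
    if "x \<in> total" for c x
    using that linear_between_scale[OF block_linear]
    by (auto simp: block_map_def fun_eq_iff fun_scale_def scale_sum_right total_mem intro!: sum.cong)
  ultimately show ?thesis by (simp add: linear_between_def)
qed

lemma path_operator_linear:
  "linear_between (fun_scale scale) (fun_scale scale) total total path_operator"
proof -
  have "path_operator x \<in> total" if x: "x \<in> total" for x
  proof -
    have "path_operator x \<tau> \<in> St \<tau>" if "\<tau> \<in> K" for \<tau>
      unfolding path_operator_def using stalk_subspace[OF that] weight_mem[OF _ x]
      by (intro subspace_neg subspace_sum) (auto simp: subspace_0)
    moreover have "path_operator x \<tau> = 0" if "\<tau> \<notin> K" for \<tau>
      unfolding path_operator_def using that path_end_in_K by (auto intro!: sum.neutral)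
    ultimately show ?thesis by (simp add: direct_sum_def)
  qed
  moreover have "path_operator (x + y) = path_operator x + path_operator y"
    if "x \<in> total" "y \<in> total" for x y
  proof
    fix \<tau>
    have "(\<Sum>\<rho>\<in>{\<rho>. is_path M \<rho>}.
          if snd (last \<rho>) = \<tau> then weight \<rho> ((x + y) (fst (hd \<rho>))) else 0) =
        (\<Sum>\<rho>\<in>{\<rho>. is_path M \<rho>}.
          (if snd (last \<rho>) = \<tau> then weight \<rho> (x (fst (hd \<rho>))) else 0) +
          (if snd (last \<rho>) = \<tau> then weight \<rho> (y (fst (hd \<rho>))) else 0))"
      using that by (intro sum.cong) (auto simp: linear_between_add[OF weight_linear] start_mem)
    then show "path_operator (x + y) \<tau> = (path_operator x + path_operator y) \<tau>"
      by (simp add: path_operator_def sum.distrib)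
  qed
  moreover have "path_operator (fun_scale scale c x) = fun_scale scale c (path_operator x)"
    if "x \<in> total" for c x
    using that linear_between_scale[OF weight_linear]
    by (auto simp: path_operator_def fun_eq_iff fun_scale_def scale_sum_right start_mem
        intro!: sum.cong)
  ultimately show ?thesis by (simp add: linear_between_def)
qed

lemma restrict_to_linear:
  "linear_between (fun_scale scale) (fun_scale scale) total total (restrict_to I)"
  using stalk_subspace
  by (auto simp: linear_between_def restrict_to_def direct_sum_def fun_eq_iff fun_scale_def subspace_0)

lemma boundary_boundary:
  assumes x: "x \<in> total" shows "boundary (boundary x) = 0"
proof
  fix \<rho>
  show "boundary (boundary x) \<rho> = 0 \<rho>"
  proof (cases "\<rho> \<in> K")
    case True
    have comp: "block \<tau> \<rho> (block \<sigma> \<tau> (x \<sigma>)) =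
        scale (of_int (incidence ord \<sigma> \<tau> * incidence ord \<tau> \<rho>)) (ext \<sigma> \<rho> (x \<sigma>))"
      if "\<sigma> \<in> K" "\<tau> \<in> K" for \<sigma> \<tau>
    proof (cases "codim_one_face \<tau> \<sigma> \<and> codim_one_face \<rho> \<tau>")
      case inc: True
      have l: "linear_between scale scale (St \<tau>) (St \<rho>) (ext \<tau> \<rho>)"
        and m: "ext \<sigma> \<tau> (x \<sigma>) \<in> St \<tau>"
        using that inc True total_mem[OF x] linear_between_mem[OF ext_linear]
        by (auto simp: codim_one_face_def intro!: ext_linear)
      have "ext \<tau> \<rho> (ext \<sigma> \<tau> (x \<sigma>)) = ext \<sigma> \<rho> (x \<sigma>)"
        using that inc True total_mem[OF x] by (intro ext_comp) (auto simp: codim_one_face_def)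
      then show ?thesis
        by (simp add: cosheaf_block_def linear_between_scale[OF l m] mult.commute)
    next
      case False
      then have "incidence ord \<sigma> \<tau> = 0 \<or> incidence ord \<tau> \<rho> = 0"
        using incidence_codim that by blast
      then show ?thesis
        using linear_between_zero[OF block_linear[OF that(2) True] stalk_subspace[OF that(2)]]
        by (auto simp: cosheaf_block_def)
    qed
    have "boundary (boundary x) \<rho> = (\<Sum>\<tau>\<in>K. \<Sum>\<sigma>\<in>K. block \<tau> \<rho> (block \<sigma> \<tau> (x \<sigma>)))"
      using True total_mem[OF x]
      by (auto simp: block_map_def intro!: sum.cong linear_between_sum[OF block_linear]
          stalk_subspace block_mem)
    also have "\<dots> = (\<Sum>\<sigma>\<in>K. \<Sum>\<tau>\<in>K. block \<tau> \<rho> (block \<sigma> \<tau> (x \<sigma>)))" by (rule sum.swap)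
    also have "\<dots> = (\<Sum>\<sigma>\<in>K. scale (of_int (\<Sum>\<tau>\<in>K. incidence ord \<sigma> \<tau> * incidence ord \<tau> \<rho>))
        (ext \<sigma> \<rho> (x \<sigma>)))"
      using comp by (auto simp: scale_sum_left intro!: sum.cong)
    also have "\<dots> = 0"
      using incidence_sum_zero[OF complex orientation _ True] by (simp del: of_int_sum)
    finally show ?thesis by simp
  qed (simp add: block_map_def)
qed

lemma boundary_path_operator:
  assumes x: "x \<in> total" and \<omega>: "\<omega> \<in> K"
  shows "boundary (path_operator x) \<omega> =
    - (\<Sum>\<rho>\<in>{\<rho>. is_path M \<rho>}. block (snd (last \<rho>)) \<omega> (weight \<rho> (x (fst (hd \<rho>)))))"
proof -
  let ?P = "{\<rho>. is_path M \<rho>}"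
  have "block \<tau> \<omega> (path_operator x \<tau>) = - (\<Sum>\<rho>\<in>?P. if snd (last \<rho>) = \<tau>
      then block \<tau> \<omega> (weight \<rho> (x (fst (hd \<rho>)))) else 0)" if \<tau>: "\<tau> \<in> K" for \<tau>
  proof -
    note l = block_linear[OF \<tau> \<omega>] and s = stalk_subspace[OF \<tau>]
    define T where "T \<rho> = (if snd (last \<rho>) = \<tau> then weight \<rho> (x (fst (hd \<rho>))) else 0)" for \<rho>
    have m: "T \<rho> \<in> St \<tau>" if "\<rho> \<in> ?P" for \<rho>
      using that weight_mem[OF _ x] subspace_0[OF s] by (auto simp: T_def)
    have "block \<tau> \<omega> (path_operator x \<tau>) = block \<tau> \<omega> (- sum T ?P)"
      by (simp add: path_operator_def T_def)
    also have "\<dots> = - block \<tau> \<omega> (sum T ?P)"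
      by (rule linear_between_minus[OF l subspace_sum[OF s m]])
    also have "block \<tau> \<omega> (sum T ?P) = (\<Sum>\<rho>\<in>?P. block \<tau> \<omega> (T \<rho>))"
      by (rule linear_between_sum[OF l s m])
    also have "\<dots> = (\<Sum>\<rho>\<in>?P. if snd (last \<rho>) = \<tau>
        then block \<tau> \<omega> (weight \<rho> (x (fst (hd \<rho>)))) else 0)"
      using linear_between_zero[OF l s] by (intro sum.cong) (auto simp: T_def)
    finally show ?thesis .
  qed
  then have "boundary (path_operator x) \<omega> = - (\<Sum>\<tau>\<in>K. \<Sum>\<rho>\<in>?P. if snd (last \<rho>) = \<tau>
      then block \<tau> \<omega> (weight \<rho> (x (fst (hd \<rho>)))) else 0)"
    using \<omega> by (simp add: block_map_def sum_negf)
  also have "\<dots> = - (\<Sum>\<rho>\<in>?P. \<Sum>\<tau>\<in>K. if snd (last \<rho>) = \<tau>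
      then block \<tau> \<omega> (weight \<rho> (x (fst (hd \<rho>)))) else 0)"
    by (subst sum.swap) simp
  also have "\<dots> = - (\<Sum>\<rho>\<in>?P. block (snd (last \<rho>)) \<omega> (weight \<rho> (x (fst (hd \<rho>)))))"
    by (simp add: finite_K path_end_in_K)
  finally show ?thesis .
qed

text \<open>At the lower simplex of a pair \<open>p\<close>, a path and its prolongation by \<open>p\<close> make opposite contributions
  to \<open>d h\<close>. What remains is the path \<open>[p]\<close>, which contributes the identity.\<close>

lemma path_operator_right_inverse:
  assumes x: "x \<in> total"
  shows "restrict_to (fst ` M) (boundary (path_operator x)) = restrict_to (fst ` M) x"
proof -
  have "boundary (path_operator x) (fst p) = x (fst p)" if p: "p \<in> M" for p
  proof -
    have "(\<Sum>\<rho>\<in>{\<rho>. is_path M \<rho>}. block (snd (last \<rho>)) (fst p) (weight \<rho> (x (fst (hd \<rho>))))) =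
        block (snd (last [p])) (fst p) (weight [p] (x (fst (hd [p]))))"
    proof (rule sum_paths_snoc[OF acyclic finite_K p])
      fix \<rho> assume \<rho>: "is_path M \<rho>" "is_path M (\<rho> @ [p])"
      have ne: "\<rho> \<noteq> []" using path_ends(1)[OF acyclic \<rho>(1)] .
      have m: "block (snd (last \<rho>)) (fst p) (weight \<rho> (x (fst (hd \<rho>)))) \<in> St (fst p)"
        by (rule block_mem[OF path_end_in_K[OF \<rho>(1)] pair(1)[OF p] weight_mem[OF \<rho>(1) x]])
      show "block (snd (last (\<rho> @ [p]))) (fst p) (weight (\<rho> @ [p]) (x (fst (hd (\<rho> @ [p]))))) =
          - block (snd (last \<rho>)) (fst p) (weight \<rho> (x (fst (hd \<rho>))))"
        using linear_between_minus[OF block_linear[OF pair(2,1)[OF p]]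
            linear_between_mem[OF matched_inverse_linear[OF p] m]] ne
        by (simp add: weight_snoc[OF ne \<rho>(2) start_mem[OF \<rho>(1) x]] block_matched_inverse[OF p m])
    next
      fix \<rho> assume "is_path M \<rho>" "\<not> codim_one_face (fst p) (snd (last \<rho>))"
      then show "block (snd (last \<rho>)) (fst p) (weight \<rho> (x (fst (hd \<rho>)))) = 0"
        using block_zero path_end_in_K by blast
    qed
    also have "\<dots> = - x (fst p)"
      using block_matched_inverse[OF p total_mem[OF x pair(1)[OF p]]]
        linear_between_minus[OF block_linear[OF pair(2,1)[OF p]]
          linear_between_mem[OF matched_inverse_linear[OF p] total_mem[OF x pair(1)[OF p]]]]
      by (simp add: weight_singleton)
    finally show ?thesis using boundary_path_operator[OF x pair(1)[OF p]] by simp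
  qed
  then show ?thesis by (auto simp: restrict_to_def fun_eq_iff)
qed

text \<open>Prolonging paths at their beginning gives the inverse on the other side. Here the source of the
  map \<open>h d\<close> is decomposed into the stalks at the upper simplices of the pairs.\<close>

lemma path_operator_left_inverse:
  assumes x: "x \<in> total"
  shows "path_operator (boundary (restrict_to (snd ` M) x)) = restrict_to (snd ` M) x"
proof
  fix \<tau>
  let ?P = "{\<rho>. is_path M \<rho>}"
  \<comment> \<open>the contribution of the path \<open>\<rho>\<close> to the block of \<open>h d\<close> from \<open>snd p\<close> to \<open>\<tau>\<close>\<close>
  define G :: "'v set \<times> 'v set \<Rightarrow> ('v set \<times> 'v set) list \<Rightarrow> 'a" where "G p \<rho> = (if snd (last \<rho>) = \<tau>
      then weight \<rho> (block (snd p) (fst (hd \<rho>)) (x (snd p))) else 0)" for p \<rho>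
  have finM: "finite M"
    using pair by (intro finite_subset[OF _ finite_cartesian_product[OF finite_K finite_K]])
      (auto simp: mem_Times_iff)
  have inj: "inj_on snd M" using matching_unique[OF acyclic] by (auto intro!: inj_onI)
  have block_m: "block (snd p) \<sigma> (x (snd p)) \<in> St \<sigma>" if "p \<in> M" "\<sigma> \<in> K" for p \<sigma>
    by (rule block_mem[OF pair(2)[OF that(1)] that(2) total_mem[OF x pair(2)[OF that(1)]]])
  have bd: "boundary (restrict_to (snd ` M) x) \<sigma> = (\<Sum>p\<in>M. block (snd p) \<sigma> (x (snd p)))"
    if \<sigma>: "\<sigma> \<in> K" for \<sigma>
  proof -
    have "boundary (restrict_to (snd ` M) x) \<sigma> =
        (\<Sum>\<tau>\<in>K. block \<tau> \<sigma> (restrict_to (snd ` M) x \<tau>))"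
      using \<sigma> by (simp add: block_map_def)
    also have "\<dots> = (\<Sum>\<tau>\<in>snd ` M. block \<tau> \<sigma> (restrict_to (snd ` M) x \<tau>))"
    proof (rule sum.mono_neutral_right[OF finite_K])
      show "snd ` M \<subseteq> K" using pair(2) by blast
      show "\<forall>\<tau>\<in>K - snd ` M. block \<tau> \<sigma> (restrict_to (snd ` M) x \<tau>) = 0"
        using linear_between_zero[OF block_linear[OF _ \<sigma>] stalk_subspace]
        by (simp add: restrict_to_def)
    qed
    also have "\<dots> = (\<Sum>p\<in>M. block (snd p) \<sigma> (x (snd p)))"
      by (simp add: sum.reindex[OF inj] restrict_to_def)
    finally show ?thesis .
  qed
  have "path_operator (boundary (restrict_to (snd ` M) x)) \<tau> = - (\<Sum>\<rho>\<in>?P. \<Sum>p\<in>M. G p \<rho>)"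
    unfolding path_operator_def G_def
    using block_m path_start_in_K
    by (auto simp: bd intro!: sum.cong
        linear_between_sum[OF weight_linear stalk_subspace[OF path_start_in_K]])
  also have "\<dots> = - (\<Sum>p\<in>M. \<Sum>\<rho>\<in>?P. G p \<rho>)" by (subst sum.swap) simp
  also have "(\<Sum>p\<in>M. \<Sum>\<rho>\<in>?P. G p \<rho>) = (\<Sum>p\<in>M. if snd p = \<tau> then - x \<tau> else 0)"
  proof (rule sum.cong[OF refl])
    fix p assume p: "p \<in> M"
    note xp = total_mem[OF x pair(2)[OF p]]
    have "(\<Sum>\<rho>\<in>?P. G p \<rho>) = G p [p]"
    proof (rule sum_paths_Cons[OF acyclic finite_K p])
      fix \<rho> assume \<rho>: "is_path M \<rho>" "is_path M (p # \<rho>)"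
      have ne: "\<rho> \<noteq> []" using path_ends(1)[OF acyclic \<rho>(1)] .
      show "G p (p # \<rho>) = - G p \<rho>"
        using ne weight_Cons[OF ne \<rho>(2) block_m[OF p pair(1)[OF p]]]
        by (simp add: G_def matched_inverse_block[OF p xp])
    next
      fix \<rho> assume \<rho>: "is_path M \<rho>" "\<not> codim_one_face (fst (hd \<rho>)) (snd p)"
      then show "G p \<rho> = 0"
        using block_zero[OF pair(2)[OF p]]
          linear_between_zero[OF weight_linear[OF \<rho>(1)] stalk_subspace[OF path_start_in_K[OF \<rho>(1)]]]
        by (simp add: G_def)
    qed
    also have "\<dots> = (if snd p = \<tau> then - x \<tau> else 0)"
      using matched_inverse_block[OF p xp] by (auto simp: G_def weight_singleton)
    finally show "(\<Sum>\<rho>\<in>?P. G p \<rho>) = (if snd p = \<tau> then - x \<tau> else 0)" .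
  qed
  also have "\<dots> = (\<Sum>\<tau>'\<in>snd ` M. if \<tau>' = \<tau> then - x \<tau> else 0)"
    by (simp add: sum.reindex[OF inj])
  also have "\<dots> = - restrict_to (snd ` M) x \<tau>"
    using finM by (simp add: restrict_to_def)
  finally show "path_operator (boundary (restrict_to (snd ` M) x)) \<tau> = restrict_to (snd ` M) x \<tau>"
    by simp
qed

lemma critical_partition:
  "critical K M = K - fst ` M - snd ` M" "fst ` M \<union> snd ` M \<subseteq> K" "fst ` M \<inter> snd ` M = {}"
proof -
  show "critical K M = K - fst ` M - snd ` M" by (auto simp: critical_def)
  show "fst ` M \<union> snd ` M \<subseteq> K" using pair by auto
  show "fst ` M \<inter> snd ` M = {}" using matching_disjoint[OF acyclic] by fastforce
qed

lemma path_operator_outside: "\<tau> \<notin> snd ` M \<Longrightarrow> path_operator x \<tau> = 0"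
  using path_ends(3)[OF acyclic] by (auto simp: path_operator_def intro!: sum.neutral)

lemma path_operator_restrict_to:
  assumes "I \<inter> fst ` M = {}" shows "path_operator (restrict_to I x) = 0"
proof -
  have "weight \<rho> (restrict_to I x (fst (hd \<rho>))) = 0" if "is_path M \<rho>" for \<rho>
    using assms path_ends(2)[OF acyclic that]
      linear_between_zero[OF weight_linear[OF that] stalk_subspace[OF path_start_in_K[OF that]]]
    by (auto simp: restrict_to_def)
  then show ?thesis by (auto simp: path_operator_def fun_eq_iff intro!: sum.neutral)
qed

lemma block_contraction_path_operator:
  "block_contraction (fun_scale scale) total boundary path_operator
    (restrict_to (critical K M)) (restrict_to (fst ` M)) (restrict_to (snd ` M))"
proof (intro block_contraction.intro block_contraction_axioms.intro)
  show "x = restrict_to (critical K M) x + restrict_to (fst ` M) x + restrict_to (snd ` M) x"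
    if "x \<in> total" for x
  proof
    fix \<sigma>
    have "\<sigma> \<in> fst ` M \<Longrightarrow> \<sigma> \<notin> snd ` M" "\<sigma> \<notin> K \<Longrightarrow> \<sigma> \<notin> fst ` M \<and> \<sigma> \<notin> snd ` M"
      using critical_partition(2,3) by blast+
    then show "x \<sigma> = (restrict_to (critical K M) x + restrict_to (fst ` M) x +
        restrict_to (snd ` M) x) \<sigma>"
      using total_outside[OF that, of \<sigma>] unfolding critical_partition(1)
      by (cases "\<sigma> \<in> K"; cases "\<sigma> \<in> fst ` M"; cases "\<sigma> \<in> snd ` M")
        (simp_all add: restrict_to_def)
  qed
  show "restrict_to (critical K M) (path_operator x) = 0" for x
    using critical_partition by (auto simp: fun_eq_iff restrict_to_def path_operator_outside)
  show "restrict_to (fst ` M) (path_operator x) = 0" for x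
  proof
    fix \<tau>
    have "\<tau> \<in> fst ` M \<Longrightarrow> \<tau> \<notin> snd ` M" using critical_partition(3) by blast
    then show "restrict_to (fst ` M) (path_operator x) \<tau> = 0 \<tau>"
      by (simp add: restrict_to_def path_operator_outside)
  qed
  show "path_operator (restrict_to (critical K M) x) = 0" for x
    unfolding critical_partition(1) by (rule path_operator_restrict_to) blast
  show "path_operator (restrict_to (snd ` M) x) = 0" for x
    using critical_partition(3) by (intro path_operator_restrict_to) blast
qed (fact vector_space_fun_scale direct_sum_subspace[OF subset_refl] boundary_linear
    path_operator_linear restrict_to_linear boundary_boundary path_operator_right_inverse
    path_operator_left_inverse)+

section \<open>The Morse complex as a reduction of the cosheaf complex\<close>

abbreviation full_complex where "full_complex \<equiv> cosheaf_complex scale K ord St ext"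
abbreviation reduced_complex where "reduced_complex \<equiv> morse_complex scale K ord St ext M"

lemma full_chains: "chains full_complex k = direct_sum (simplices_of_dim K k) St"
  by (simp add: cosheaf_complex_def)

lemma full_chains_total: "chains full_complex k \<subseteq> total"
  using subspace_0[OF stalk_subspace]
  by (force simp: full_chains direct_sum_def simplices_of_dim_def)

lemma codim_one_face_dim:
  "codim_one_face \<tau> \<sigma> \<Longrightarrow> \<sigma> \<in> simplices_of_dim K k \<Longrightarrow> \<tau> \<in> K \<Longrightarrow>
    \<tau> \<in> simplices_of_dim K (k - 1)"
  by (auto simp: codim_one_face_def simplices_of_dim_def)

text \<open>On chains of one degree the degreewise boundary is the total one, because blocks between
  simplices whose dimensions do not differ by one vanish.\<close>

lemma full_bd:
  assumes x: "x \<in> chains full_complex k" shows "bd full_complex k x = boundary x"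
proof
  fix \<tau>
  have "(\<Sum>\<sigma>\<in>simplices_of_dim K k. block \<sigma> \<tau> (x \<sigma>)) = (\<Sum>\<sigma>\<in>K. block \<sigma> \<tau> (x \<sigma>))"
    if \<tau>: "\<tau> \<in> K"
  proof (rule sum.mono_neutral_left[OF finite_K])
    show "\<forall>\<sigma>\<in>K - simplices_of_dim K k. block \<sigma> \<tau> (x \<sigma>) = 0"
      using x linear_between_zero[OF block_linear[OF _ \<tau>] stalk_subspace]
      by (auto simp: full_chains direct_sum_def)
  qed (auto simp: simplices_of_dim_def)
  moreover have "(\<Sum>\<sigma>\<in>simplices_of_dim K k. block \<sigma> \<tau> (x \<sigma>)) = 0"
    if "\<tau> \<in> K" "\<tau> \<notin> simplices_of_dim K (k - 1)"
  proof (intro sum.neutral ballI block_zero)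
    fix \<sigma> assume "\<sigma> \<in> simplices_of_dim K k"
    then show "\<sigma> \<in> K" "\<not> codim_one_face \<tau> \<sigma>"
      using that codim_one_face_dim by (auto simp: simplices_of_dim_def)
  qed
  ultimately show "bd full_complex k x \<tau> = boundary x \<tau>"
    by (auto simp: cosheaf_complex_def block_map_def simplices_of_dim_def)
qed

lemma full_boundary_mem:
  assumes x: "x \<in> chains full_complex k" shows "boundary x \<in> chains full_complex (k - 1)"
proof -
  have "boundary x \<in> total" using x full_chains_total fs.linear_between_mem[OF boundary_linear] by blast
  moreover have "bd full_complex k x \<tau> = 0" if "\<tau> \<notin> simplices_of_dim K (k - 1)" for \<tau>
    using that by (simp add: cosheaf_complex_def block_map_def)
  ultimately show ?thesis
    unfolding full_bd[OF x] by (simp add: full_chains direct_sum_def simplices_of_dim_def)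
qed

lemma full_chain_complex: "is_chain_complex (fun_scale scale) full_complex"
  unfolding is_chain_complex_def
proof (intro conjI allI ballI)
  fix k
  show s: "fs.subspace (chains full_complex k)"
    unfolding full_chains by (rule direct_sum_subspace) (auto simp: simplices_of_dim_def)
  have t: "x \<in> total" if "x \<in> chains full_complex k" for x using that full_chains_total by blast
  show "linear_between (fun_scale scale) (fun_scale scale)
      (chains full_complex k) (chains full_complex (k - 1)) (bd full_complex k)"
    by (simp add: linear_between_def full_bd fs.subspace_add[OF s] fs.subspace_scale[OF s]
        full_boundary_mem t
        fs.linear_between_add[OF boundary_linear] fs.linear_between_scale[OF boundary_linear])
  show "bd full_complex (k - 1) (bd full_complex k x) = 0" if "x \<in> chains full_complex k" for x
    using that by (simp add: full_bd full_boundary_mem boundary_boundary t)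
qed

lemma full_path_operator_mem:
  assumes x: "x \<in> chains full_complex k" shows "path_operator x \<in> chains full_complex (k + 1)"
proof -
  have "path_operator x \<in> total"
    using x full_chains_total fs.linear_between_mem[OF path_operator_linear] by blast
  moreover have "path_operator x \<tau> = 0" if \<tau>: "\<tau> \<notin> simplices_of_dim K (k + 1)" for \<tau>
  proof -
    have "weight \<rho> (x (fst (hd \<rho>))) = 0" if \<rho>: "is_path M \<rho>" "snd (last \<rho>) = \<tau>" for \<rho>
    proof -
      have "fst (hd \<rho>) \<notin> simplices_of_dim K k"
        using \<tau> \<rho> path_card[OF acyclic \<rho>(1)] path_end_in_K[OF \<rho>(1)]
        by (auto simp: simplices_of_dim_def)
      then have "x (fst (hd \<rho>)) = 0" using x by (auto simp: full_chains direct_sum_def)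
      then show ?thesis
        using linear_between_zero[OF weight_linear stalk_subspace] \<rho>(1) path_start_in_K by metis
    qed
    then show ?thesis by (auto simp: path_operator_def intro!: sum.neutral)
  qed
  ultimately show ?thesis by (simp add: full_chains direct_sum_def simplices_of_dim_def)
qed

lemma reduced_chains:
  "chains reduced_complex k = {x \<in> chains full_complex k. restrict_to (critical K M) x = x}"
proof -
  have "x \<in> direct_sum (critical K M \<inter> simplices_of_dim K k) St \<longleftrightarrow>
      x \<in> direct_sum (simplices_of_dim K k) St \<and> restrict_to (critical K M) x = x" for x
  proof -
    have "0 \<in> St \<sigma>" if "\<sigma> \<in> simplices_of_dim K k" for \<sigma>
      using that stalk_subspace subspace_0 by (auto simp: simplices_of_dim_def)
    then show ?thesis
      unfolding direct_sum_def restrict_to_def fun_eq_iff by (auto split: if_splits)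
  qed
  then show ?thesis by (auto simp: full_chains morse_complex_def)
qed

text \<open>The two incidence symbols of a summand of the Morse boundary can be moved to the maps they
  belong to: if one of them vanishes then so do both expressions, and otherwise the maps are
  linear.\<close>

lemma morse_summand:
  assumes "\<alpha> \<in> K" "\<omega> \<in> K" and \<rho>: "is_path M \<rho>" and z: "z \<in> St \<alpha>"
  defines "\<sigma> \<equiv> fst (hd \<rho>)" and "\<tau> \<equiv> snd (last \<rho>)"
  shows "scale (of_int (incidence ord \<tau> \<omega> * incidence ord \<alpha> \<sigma>))
      (ext \<tau> \<omega> (weight \<rho> (ext \<alpha> \<sigma> z))) = block \<tau> \<omega> (weight \<rho> (block \<alpha> \<sigma> z))"
proof -
  have K: "\<sigma> \<in> K" "\<tau> \<in> K"
    unfolding \<sigma>_def \<tau>_def by (rule path_start_in_K[OF \<rho>], rule path_end_in_K[OF \<rho>])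
  note w = weight_linear[OF \<rho>, folded \<sigma>_def \<tau>_def]
  show ?thesis
  proof (cases "codim_one_face \<sigma> \<alpha> \<and> codim_one_face \<omega> \<tau>")
    case True
    have e: "ext \<alpha> \<sigma> z \<in> St \<sigma>"
      using True K assms by (intro linear_between_mem[OF ext_linear]) (auto simp: codim_one_face_def)
    have l: "linear_between scale scale (St \<tau>) (St \<omega>) (ext \<tau> \<omega>)"
      using True K assms by (intro ext_linear) (auto simp: codim_one_face_def)
    show ?thesis
      unfolding cosheaf_block_def linear_between_scale[OF w e]
        linear_between_scale[OF l linear_between_mem[OF w e]]
      by simp
  next
    case False
    then have "incidence ord \<tau> \<omega> = 0 \<or> incidence ord \<alpha> \<sigma> = 0"
      using incidence_codim K assms(1) by blast
    then show ?thesis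
      using linear_between_zero[OF w stalk_subspace[OF K(1)]]
        linear_between_zero[OF block_linear[OF K(2) assms(2)] stalk_subspace[OF K(2)]]
      by (auto simp: cosheaf_block_def)
  qed
qed

text \<open>The block sum over paths is \<open>- d h d\<close> between critical simplices, because \<open>h\<close> is minus the sum of
  the path weights.\<close>

lemma reduced_bd:
  assumes x: "x \<in> chains reduced_complex k"
  shows "bd reduced_complex k x = restrict_to (critical K M) (boundary x) -
    restrict_to (critical K M) (boundary (path_operator (boundary x)))"
proof
  fix \<omega>
  let ?A = "critical K M" and ?P = "{\<rho>. is_path M \<rho>}"
  let ?Ak = "?A \<inter> simplices_of_dim K k"
  have xC: "x \<in> chains full_complex k" using x by (simp add: reduced_chains)
  have x': "x \<in> direct_sum ?Ak St" using x by (simp add: morse_complex_def)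
  have xT: "x \<in> total" using xC full_chains_total by blast
  have dx: "boundary x \<in> chains full_complex (k - 1)" by (rule full_boundary_mem[OF xC])
  have dxT: "boundary x \<in> total" using dx full_chains_total by blast
  have dhdx: "boundary (path_operator (boundary x)) \<in> chains full_complex (k - 1)"
    using full_boundary_mem[OF full_path_operator_mem[OF dx]] by simp
  have bd_sum: "boundary x \<sigma> = (\<Sum>\<alpha>\<in>?Ak. block \<alpha> \<sigma> (x \<alpha>))" if \<sigma>: "\<sigma> \<in> K" for \<sigma>
  proof -
    have "(\<Sum>\<alpha>\<in>K. block \<alpha> \<sigma> (x \<alpha>)) = (\<Sum>\<alpha>\<in>?Ak. block \<alpha> \<sigma> (x \<alpha>))"
    proof (rule sum.mono_neutral_right[OF finite_K])
      show "\<forall>\<alpha>\<in>K - ?Ak. block \<alpha> \<sigma> (x \<alpha>) = 0"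
        using x' linear_between_zero[OF block_linear[OF _ \<sigma>] stalk_subspace]
        by (auto simp: direct_sum_def)
    qed (auto simp: simplices_of_dim_def)
    then show ?thesis using \<sigma> by (simp add: block_map_def)
  qed
  show "bd reduced_complex k x \<omega> = (restrict_to ?A (boundary x) -
      restrict_to ?A (boundary (path_operator (boundary x)))) \<omega>"
  proof (cases "\<omega> \<in> ?A \<inter> simplices_of_dim K (k - 1)")
    case True
    then have \<omega>: "\<omega> \<in> K" "\<omega> \<in> ?A" by (auto simp: simplices_of_dim_def)
    have K: "\<alpha> \<in> K" if "\<alpha> \<in> ?Ak" for \<alpha> using that by (simp add: simplices_of_dim_def)
    have weight_sum: "block (snd (last \<rho>)) \<omega> (weight \<rho> (boundary x (fst (hd \<rho>)))) =
        (\<Sum>\<alpha>\<in>?Ak. block (snd (last \<rho>)) \<omega> (weight \<rho> (block \<alpha> (fst (hd \<rho>)) (x \<alpha>))))"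
      if \<rho>: "\<rho> \<in> ?P" for \<rho>
    proof -
      have p: "is_path M \<rho>" using \<rho> by simp
      note start = path_start_in_K[OF p] and end_K = path_end_in_K[OF p]
      have m: "block \<alpha> (fst (hd \<rho>)) (x \<alpha>) \<in> St (fst (hd \<rho>))" if "\<alpha> \<in> ?Ak" for \<alpha>
        by (rule block_mem[OF K[OF that] start total_mem[OF xT K[OF that]]])
      have "linear_between scale scale (St (fst (hd \<rho>))) (St \<omega>)
          (\<lambda>y. block (snd (last \<rho>)) \<omega> (weight \<rho> y))"
        by (rule linear_between_compose[OF weight_linear[OF p] block_linear[OF end_K \<omega>(1)]])
      then show ?thesis
        unfolding bd_sum[OF start] by (rule linear_between_sum[OF _ stalk_subspace[OF start] m])
    qed
    have "bd reduced_complex k x \<omega> = (\<Sum>\<alpha>\<in>?Ak. morse_block scale ord St ext M \<alpha> \<omega> (x \<alpha>))"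
      using True by (simp add: morse_complex_def block_map_def)
    also have "\<dots> = (\<Sum>\<alpha>\<in>?Ak. block \<alpha> \<omega> (x \<alpha>) +
        (\<Sum>\<rho>\<in>?P. block (snd (last \<rho>)) \<omega> (weight \<rho> (block \<alpha> (fst (hd \<rho>)) (x \<alpha>)))))"
    proof (rule sum.cong[OF refl])
      fix \<alpha> assume \<alpha>: "\<alpha> \<in> ?Ak"
      show "morse_block scale ord St ext M \<alpha> \<omega> (x \<alpha>) = block \<alpha> \<omega> (x \<alpha>) +
          (\<Sum>\<rho>\<in>?P. block (snd (last \<rho>)) \<omega> (weight \<rho> (block \<alpha> (fst (hd \<rho>)) (x \<alpha>))))"
        unfolding morse_block_def Let_def cosheaf_block_def[of _ _ _ \<alpha> \<omega>]
        by (intro arg_cong2[where f = "(+)"] refl sum.cong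
            morse_summand[OF K[OF \<alpha>] \<omega>(1) _ total_mem[OF xT K[OF \<alpha>]]]) simp
    qed
    also have "\<dots> = boundary x \<omega> +
        (\<Sum>\<rho>\<in>?P. block (snd (last \<rho>)) \<omega> (weight \<rho> (boundary x (fst (hd \<rho>)))))"
      unfolding sum.distrib bd_sum[OF \<omega>(1)]
      by (subst sum.swap)
        (rule arg_cong2[where f = "(+)", OF refl sum.cong[OF refl weight_sum[symmetric]]])
    also have "\<dots> = boundary x \<omega> - boundary (path_operator (boundary x)) \<omega>"
      by (simp add: boundary_path_operator[OF dxT \<omega>(1)])
    finally show ?thesis using \<omega>(2) by (simp add: restrict_to_def)
  next
    case False
    then have "bd reduced_complex k x \<omega> = 0"
      by (auto simp: morse_complex_def block_map_def)
    moreover have "boundary x \<omega> = 0" "boundary (path_operator (boundary x)) \<omega> = 0" if "\<omega> \<in> ?A"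
      using False that dx dhdx by (auto simp: full_chains direct_sum_def)
    ultimately show ?thesis by (simp add: restrict_to_def)
  qed
qed

proposition reduced_complex_quasi_isomorphism:
  "is_chain_complex (fun_scale scale) reduced_complex"
  "is_quasi_isomorphism (fun_scale scale) reduced_complex full_complex
    (\<lambda>k x. x - path_operator (boundary x))"
proof -
  interpret block_contraction "fun_scale scale" total boundary path_operator
    "restrict_to (critical K M)" "restrict_to (fst ` M)" "restrict_to (snd ` M)"
    by (rule block_contraction_path_operator)
  have r: "restrict_to (critical K M) x \<in> chains full_complex k" if "x \<in> chains full_complex k" for x k
    using that subspace_0[OF stalk_subspace]
    by (auto simp: full_chains direct_sum_def restrict_to_def simplices_of_dim_def)
  have rr: "restrict_to (critical K M) (restrict_to (critical K M) x) = restrict_to (critical K M) x"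
    for x by (simp add: restrict_to_def fun_eq_iff)
  note q = reduced_complex_quasi_isomorphic[OF full_chain_complex full_chains_total full_bd
      full_path_operator_mem r rr reduced_chains reduced_bd]
  show "is_chain_complex (fun_scale scale) reduced_complex"
    and "is_quasi_isomorphism (fun_scale scale) reduced_complex full_complex
      (\<lambda>k x. x - path_operator (boundary x))"
    by (auto intro: q)
qed

end

theorem theorem5p2:
  fixes scale :: "'k::field \<Rightarrow> 'a::ab_group_add \<Rightarrow> 'a"
    and K :: "'v set set"
    and ord :: "'v set \<Rightarrow> 'v rel"
    and St :: "'v set \<Rightarrow> 'a set"
    and ext :: "'v set \<Rightarrow> 'v set \<Rightarrow> 'a \<Rightarrow> 'a"
    and M :: "('v set \<times> 'v set) set"
  assumes "finite_simplicial_complex K"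
    and "local_orientation K ord"
    and "cosheaf scale K St ext"
    and "acyclic_partial_matching K M"
    and "compatible_matching St ext M"
  shows "is_chain_complex (fun_scale scale) (morse_complex scale K ord St ext M) \<and>
         quasi_isomorphic (fun_scale scale)
           (morse_complex scale K ord St ext M) (cosheaf_complex scale K ord St ext)"
proof -
  interpret matched_cosheaf scale K St ext ord M
    using assms by (intro matched_cosheaf.intro matched_cosheaf_axioms.intro)
  show ?thesis
    unfolding quasi_isomorphic_def
    by (intro conjI r_into_equivclp exI) (rule reduced_complex_quasi_isomorphism full_chain_complex)+
qed

end
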